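(* Let $G$ be a finite group, let $\mathcal{F}$ be the field algebra of the $G$-spin model with its action of the quantum double $D(G)$, and let $\mathcal{F}\rtimes D(G)$ be the crossed product $C^*$-algebra with its left $\widehat{D(G)}$-module algebra action $(y,\delta_x)(F\otimes(g,h))=\delta_{x,h}\,F\otimes(gy^{-1},h)$. Let $E_2\colon\mathcal{F}\rtimes D(G)\to\mathcal{F}$ be the conditional expectation given by the action of the integral element $E_2=\frac1{|G|}\sum_{y\in G}(y,\delta_u)$ of $\widehat{D(G)}$, and let $e_2$ be the Jones projection of $E_2$. Then there exists a $C^*$-isomorphism between the iterated crossed product $C^*$-algebra $\mathcal{F}\rtimes D(G)\rtimes\widehat{D(G)}$ and the $C^*$-algebra $\langle\mathcal{F}\rtimes D(G),e_2\rangle_{C^*}$ obtained from the $C^*$-basic construction for the inclusion $\mathcal{F}\subseteq\mathcal{F}\rtimes D(G)$; that is, $$\mathcal{F}\rtimes D(G)\rtimes\widehat{D(G)}\cong\langle\mathcal{F}\rtimes D(G),e_2\rangle_{C^*}.$$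
   Context: Throughout, $G$ is a finite group with unit $u$, all algebras are unital associative over $\mathbb{C}$, $\delta_{g,h}$ is the Kronecker delta, and Sweedler notation $\Delta(a)=\sum_{(a)}a_{(1)}\otimes a_{(2)}$ is used. Quantum double. $D(G)$ is the Hopf $C^*$-algebra with linear basis $\{(g,h):g,h\in G\}$ and structure $(g_1,h_1)(g_2,h_2)=\delta_{g_1h_1,h_1g_2}(g_1,h_1h_2)$, unit $I_{D(G)}=\sum_{g\in G}(g,u)$, $\Delta(g,h)=\sum_{t\in G}(t,h)\otimes(t^{-1}g,h)$, $\varepsilon(g,h)=\delta_{g,u}$, $S(g,h)=(h^{-1}g^{-1}h,h^{-1})$, $(g,h)^*=(h^{-1}gh,h^{-1})$. Field algebra. $\mathcal{F}_{\mathrm{loc}}$ is the unital $*$-algebra (unit $I$) generated by $\delta_g(x),\rho_h(l)$ ($g,h\in G$, $x\in\mathbb{Z}$, $l\in\mathbb{Z}+\frac12$) subject to: $\sum_{g}\delta_g(x)=I=\rho_u(l)$; $\delta_{g_1}(x)\delta_{g_2}(x)=\delta_{g_1,g_2}\delta_{g_1}(x)$; $\rho_{h_1}(l)\rho_{h_2}(l)=\rho_{h_1h_2}(l)$; $\delta_{g_1}(x)\delta_{g_2}(x')=\delta_{g_2}(x')\delta_{g_1}(x)$; $\rho_h(l)\delta_g(x)=\delta_{hg}(x)\rho_h(l)$ if $l<x$ and $=\delta_g(x)\rho_h(l)$ if $l>x$; $\rho_{h_1}(l)\rho_{h_2}(l')=\rho_{h_2}(l')\rho_{h_2^{-1}h_1h_2}(l)$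 if $l>l'$ and $=\rho_{h_1h_2h_1^{-1}}(l')\rho_{h_1}(l)$ if $l<l'$; with $\delta_g(x)^*=\delta_g(x)$, $\rho_h(l)^*=\rho_{h^{-1}}(l)$. The field algebra $\mathcal{F}$ is the $C^*$-inductive limit of $\mathcal{F}_{\mathrm{loc}}$, i.e. the $C^*$-completion of $\mathcal{F}_{\mathrm{loc}}$ viewed as the increasing union of the finite-dimensional $C^*$-algebras generated by the generators located in finite intervals. Action. $D(G)$ acts on $\mathcal{F}$ by $(g,h)\delta_f(x)=\delta_{g,u}\delta_{hf}(x)$, $(g,h)\rho_t(l)=\delta_{g,hth^{-1}}\rho_g(l)$, extended by $a(T_1T_2)=\sum_{(a)}a_{(1)}(T_1)a_{(2)}(T_2)$, linearity and continuity; it is known that $\mathcal{F}$ is then a $D(G)$-module algebra, with $a(T^* )=(S(a^* )(T))^*$. Crossed product. $\mathcal{F}\rtimes D(G)$ is the $C^*$-algebra obtained (by $C^*$-inductive limit) from the vector space $\mathcal{F}_{\mathrm{loc}}\otimes D(G)$ with $(T\otimes a)(F\otimes b)=\sum_{(a)}T\,a_{(1)}(F)\otimes a_{(2)}b$ and $(T\otimes a)^*=(I\otimes a^* )(T^*\otimes I_{D(G)})$. $\mathcal{F}$ is identified with $\mathcal{F}\otimes I_{D(G)}\subseteq\mathcal{F}\rtimes D(G)$. Dual. $\widehat{D(G)}$ is the dual Hopf $C^*$-algebra, with linear basis $\{(y,\delta_x):y,x\in G\}$ and structure $(y,\delta_x)(w,\delta_z)=\delta_{x,z}(yw,\delta_x)$,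 unit $\sum_{x}(u,\delta_x)$, $\widetilde\Delta(y,\delta_x)=\sum_{t\in G}(y,\delta_{t^{-1}})\otimes(tyt^{-1},\delta_{tx})$, $(y,\delta_x)^*=(y^{-1},\delta_x)$, $\widetilde\varepsilon(y,\delta_x)=\delta_{x,u}$, $\widetilde S(y,\delta_x)=(x^{-1}y^{-1}x,\delta_{x^{-1}})$. The displayed action makes $\mathcal{F}\rtimes D(G)$ a left $\widehat{D(G)}$-module algebra, and $E_2(F\otimes(g,h))=\frac{1}{|G|}\delta_{h,u}\,F\otimes I_{D(G)}$ defines a conditional expectation onto $\mathcal{F}$. Iterated crossed product. $\mathcal{F}\rtimes D(G)\rtimes\widehat{D(G)}$ is the crossed product $C^*$-algebra $(\mathcal{F}\rtimes D(G))\rtimes\widehat{D(G)}$ for this action, defined by the same crossed product formulas on $(\mathcal{F}\rtimes D(G))\otimes\widehat{D(G)}$: $(X\otimes a)(Y\otimes b)=\sum_{(a)}X\,a_{(1)}(Y)\otimes a_{(2)}b$ and $(X\otimes a)^*=(1\otimes a^* )(X^*\otimes 1)$. $C^*$-basic construction. For a faithful conditional expectation $\Gamma\colon B\to A$ of a unital $C^*$-algebra onto a unital $C^*$-subalgebra, let $\overline{B_A}$ be the Hilbert $A$-module completion of $B$ (as right $A$-module) for $\langle x,y\rangle=\Gamma(x^*y)$, let $L_A(\overline{B_A})$ be the $C^*$-algebra of adjointable $A$-module maps, let $\lambda(b)x=bx$ be the left multiplication representation of $B$, and let the Jones projection $\gamma_A\in L_A(\overline{B_A})$ be the bounded extension of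 $x\mapsto\Gamma(x)$. Then $\langle B,\gamma_A\rangle_{C^*}$ is the norm closure of $\mathrm{span}\{\lambda(x)\gamma_A\lambda(y):x,y\in B\}$ in $L_A(\overline{B_A})$. Here it is applied to $\Gamma=E_2$, $B=\mathcal{F}\rtimes D(G)$, $A=\mathcal{F}$, with Jones projection denoted $e_2$. *)

theory Defs
  imports "HOL-Analysis.Bounded_Linear_Function" "HOL-Algebra.Group"
begin

section \<open>Unital $C^*$-algebras\<close>

class cstar_algebra = real_normed_algebra_1 + banach +
  fixes scaleC :: "complex \<Rightarrow> 'a \<Rightarrow> 'a" (infixr "*\<^sub>C" 75)
    and star :: "'a \<Rightarrow> 'a"
  assumes scaleC_of_real: "complex_of_real r *\<^sub>C x = r *\<^sub>R x"
    and scaleC_add_right: "c *\<^sub>C (x + y) = c *\<^sub>C x + c *\<^sub>C y"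
    and scaleC_add_left: "(c + d) *\<^sub>C x = c *\<^sub>C x + d *\<^sub>C x"
    and scaleC_scaleC: "c *\<^sub>C d *\<^sub>C x = (c * d) *\<^sub>C x"
    and mult_scaleC_left: "(c *\<^sub>C x) * y = c *\<^sub>C (x * y)"
    and mult_scaleC_right: "x * (c *\<^sub>C y) = c *\<^sub>C (x * y)"
    and norm_scaleC: "norm (c *\<^sub>C x) = cmod c * norm x"
    and star_star: "star (star x) = x"
    and star_add: "star (x + y) = star x + star y"
    and star_scaleC: "star (c *\<^sub>C x) = cnj c *\<^sub>C star x"
    and star_mult: "star (x * y) = star y * star x"
    and cstar_identity: "norm (star x * x) = (norm x)\<^sup>2"

definition bounded_clinear :: "('a::cstar_algebra \<Rightarrow> 'b::cstar_algebra) \<Rightarrow> bool" where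
  "bounded_clinear f \<longleftrightarrow> bounded_linear f \<and> (\<forall>c x. f (c *\<^sub>C x) = c *\<^sub>C f x)"


section \<open>Finite-dimensional Hopf $*$-algebras by structure constants\<close>

text \<open>
  An algebra with a finite linear basis \<open>hbasis\<close> is given by the values of its structure maps on
  basis elements; a vector is its family of coefficients, and the tensor square has the pairs of
  basis elements as basis. The maps \<open>hmult\<close>, \<open>hcomult\<close>, \<open>hcounit\<close> and \<open>hantipode\<close> are meant to be
  extended linearly, \<open>hstar\<close> conjugate-linearly.
\<close>

record 'i hopf_star_algebra =
  hbasis :: "'i set"
  hmult :: "'i \<Rightarrow> 'i \<Rightarrow> ('i \<Rightarrow> complex)"
  hunit :: "'i \<Rightarrow> complex"
  hcomult :: "'i \<Rightarrow> ('i \<times> 'i \<Rightarrow> complex)"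
  hcounit :: "'i \<Rightarrow> complex"
  hantipode :: "'i \<Rightarrow> ('i \<Rightarrow> complex)"
  hstar :: "'i \<Rightarrow> ('i \<Rightarrow> complex)"

definition bvec :: "'i \<Rightarrow> ('i \<Rightarrow> complex)" where
  "bvec i = (\<lambda>k. if k = i then 1 else 0)"

text \<open>The quantum double \<open>D(G)\<close>; the pair \<open>(g, h)\<close> is the basis element $(g,h)$.\<close>

definition quantum_double :: "('g, 'z) monoid_scheme \<Rightarrow> ('g \<times> 'g) hopf_star_algebra" where
  "quantum_double G =
    \<lparr> hbasis = carrier G \<times> carrier G,
      hmult = (\<lambda>(g1, h1) (g2, h2).
        if g1 \<otimes>\<^bsub>G\<^esub> h1 = h1 \<otimes>\<^bsub>G\<^esub> g2 then bvec (g1, h1 \<otimes>\<^bsub>G\<^esub> h2) else (\<lambda>_. 0)),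
      hunit = (\<lambda>k. \<Sum>g\<in>carrier G. bvec (g, \<one>\<^bsub>G\<^esub>) k),
      hcomult = (\<lambda>(g, h) k. \<Sum>t\<in>carrier G. bvec ((t, h), (inv\<^bsub>G\<^esub> t \<otimes>\<^bsub>G\<^esub> g, h)) k),
      hcounit = (\<lambda>(g, h). if g = \<one>\<^bsub>G\<^esub> then 1 else 0),
      hantipode = (\<lambda>(g, h). bvec (inv\<^bsub>G\<^esub> h \<otimes>\<^bsub>G\<^esub> inv\<^bsub>G\<^esub> g \<otimes>\<^bsub>G\<^esub> h, inv\<^bsub>G\<^esub> h)),
      hstar = (\<lambda>(g, h). bvec (inv\<^bsub>G\<^esub> h \<otimes>\<^bsub>G\<^esub> g \<otimes>\<^bsub>G\<^esub> h, inv\<^bsub>G\<^esub> h)) \<rparr>"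

text \<open>The dual of \<open>D(G)\<close>; the pair \<open>(y, x)\<close> is the basis element $(y,\delta_x)$.\<close>

definition dual_double :: "('g, 'z) monoid_scheme \<Rightarrow> ('g \<times> 'g) hopf_star_algebra" where
  "dual_double G =
    \<lparr> hbasis = carrier G \<times> carrier G,
      hmult = (\<lambda>(y, x) (w, z). if x = z then bvec (y \<otimes>\<^bsub>G\<^esub> w, x) else (\<lambda>_. 0)),
      hunit = (\<lambda>k. \<Sum>x\<in>carrier G. bvec (\<one>\<^bsub>G\<^esub>, x) k),
      hcomult = (\<lambda>(y, x) k. \<Sum>t\<in>carrier G.
        bvec ((y, inv\<^bsub>G\<^esub> t), (t \<otimes>\<^bsub>G\<^esub> y \<otimes>\<^bsub>G\<^esub> inv\<^bsub>G\<^esub> t, t \<otimes>\<^bsub>G\<^esub> x)) k),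
      hcounit = (\<lambda>(y, x). if x = \<one>\<^bsub>G\<^esub> then 1 else 0),
      hantipode = (\<lambda>(y, x). bvec (inv\<^bsub>G\<^esub> x \<otimes>\<^bsub>G\<^esub> inv\<^bsub>G\<^esub> y \<otimes>\<^bsub>G\<^esub> x, inv\<^bsub>G\<^esub> x)),
      hstar = (\<lambda>(y, x). bvec (inv\<^bsub>G\<^esub> y, x)) \<rparr>"

text \<open>The integral $\frac{1}{|G|}\sum_{y}(y,\delta_u)$ of the dual.\<close>

definition dual_integral :: "('g, 'z) monoid_scheme \<Rightarrow> ('g \<times> 'g \<Rightarrow> complex)" where
  "dual_integral G = (\<lambda>k. (1 / of_nat (card (carrier G))) * (\<Sum>y\<in>carrier G. bvec (y, \<one>\<^bsub>G\<^esub>) k))"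

definition lin_act ::
    "'i hopf_star_algebra \<Rightarrow> ('i \<Rightarrow> 'a \<Rightarrow> 'a) \<Rightarrow> ('i \<Rightarrow> complex) \<Rightarrow> 'a \<Rightarrow> 'a::cstar_algebra" where
  "lin_act H act v X = (\<Sum>i\<in>hbasis H. v i *\<^sub>C act i X)"


section \<open>The field algebra\<close>

text \<open>
  Terms in the generators; \<open>Rho h n\<close> stands for $\rho_h(n+\frac12)$, so that the half-integers are
  indexed by \<open>int\<close>.
\<close>

datatype 'g field_term =
    Delta 'g int
  | Rho 'g int
  | One
  | Scale complex "'g field_term"
  | Add "'g field_term" "'g field_term"
  | Mul "'g field_term" "'g field_term"
  | Star "'g field_term"

definition half :: "int \<Rightarrow> rat" where
  "half n = of_int n + 1 / 2"

definition field_terms :: "('g, 'z) monoid_scheme \<Rightarrow> 'g field_term set" where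
  "field_terms G = {t. set_field_term t \<subseteq> carrier G}"

text \<open>
  The least congruence containing the axioms of unital $*$-algebras over \<open>\<complex>\<close> (with \<open>Scale 0 t\<close> as
  the zero element) and the defining relations: \<open>field_terms G\<close> modulo this congruence is the
  universal $*$-algebra $\mathcal F_{\mathrm{loc}}$ with these generators and relations.
\<close>

inductive field_rel :: "('g, 'z) monoid_scheme \<Rightarrow> 'g field_term \<Rightarrow> 'g field_term \<Rightarrow> bool"
  for G (structure) where
  refl: "field_rel G s s"
| sym: "field_rel G s t \<Longrightarrow> field_rel G t s"
| trans: "field_rel G s t \<Longrightarrow> field_rel G t r \<Longrightarrow> field_rel G s r"
| Scale_cong: "field_rel G s t \<Longrightarrow> field_rel G (Scale c s) (Scale c t)"
| Add_cong: "field_rel G s t \<Longrightarrow> field_rel G s' t' \<Longrightarrow> field_rel G (Add s s') (Add t t')"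
| Mul_cong: "field_rel G s t \<Longrightarrow> field_rel G s' t' \<Longrightarrow> field_rel G (Mul s s') (Mul t t')"
| Star_cong: "field_rel G s t \<Longrightarrow> field_rel G (Star s) (Star t)"

| Add_assoc: "field_rel G (Add (Add r s) t) (Add r (Add s t))"
| Add_commute: "field_rel G (Add s t) (Add t s)"
| Add_zero: "field_rel G (Add s (Scale 0 t)) s"
| Scale_one: "field_rel G (Scale 1 s) s"
| Scale_Scale: "field_rel G (Scale c (Scale d s)) (Scale (c * d) s)"
| Scale_add_left: "field_rel G (Scale (c + d) s) (Add (Scale c s) (Scale d s))"
| Scale_add_right: "field_rel G (Scale c (Add s t)) (Add (Scale c s) (Scale c t))"
| Mul_assoc: "field_rel G (Mul (Mul r s) t) (Mul r (Mul s t))"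
| One_Mul: "field_rel G (Mul One s) s"
| Mul_One: "field_rel G (Mul s One) s"
| Mul_Add_left: "field_rel G (Mul (Add r s) t) (Add (Mul r t) (Mul s t))"
| Mul_Add_right: "field_rel G (Mul r (Add s t)) (Add (Mul r s) (Mul r t))"
| Mul_Scale_left: "field_rel G (Mul (Scale c s) t) (Scale c (Mul s t))"
| Mul_Scale_right: "field_rel G (Mul s (Scale c t)) (Scale c (Mul s t))"
| Star_Star: "field_rel G (Star (Star s)) s"
| Star_Add: "field_rel G (Star (Add s t)) (Add (Star s) (Star t))"
| Star_Scale: "field_rel G (Star (Scale c s)) (Scale (cnj c) (Star s))"
| Star_Mul: "field_rel G (Star (Mul s t)) (Mul (Star t) (Star s))"

| Delta_sum: "distinct gs \<Longrightarrow> set gs = carrier G \<Longrightarrow>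
    field_rel G (foldr (\<lambda>g. Add (Delta g x)) gs (Scale 0 One)) One"
| Rho_unit: "field_rel G (Rho \<one> l) One"
| Delta_orth: "g1 \<in> carrier G \<Longrightarrow> g2 \<in> carrier G \<Longrightarrow>
    field_rel G (Mul (Delta g1 x) (Delta g2 x)) (if g1 = g2 then Delta g1 x else Scale 0 One)"
| Rho_mult: "h1 \<in> carrier G \<Longrightarrow> h2 \<in> carrier G \<Longrightarrow>
    field_rel G (Mul (Rho h1 l) (Rho h2 l)) (Rho (h1 \<otimes> h2) l)"
| Delta_commute: "g1 \<in> carrier G \<Longrightarrow> g2 \<in> carrier G \<Longrightarrow>
    field_rel G (Mul (Delta g1 x) (Delta g2 x')) (Mul (Delta g2 x') (Delta g1 x))"
| Rho_Delta_less: "h \<in> carrier G \<Longrightarrow> g \<in> carrier G \<Longrightarrow> half l < of_int x \<Longrightarrow>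
    field_rel G (Mul (Rho h l) (Delta g x)) (Mul (Delta (h \<otimes> g) x) (Rho h l))"
| Rho_Delta_greater: "h \<in> carrier G \<Longrightarrow> g \<in> carrier G \<Longrightarrow> half l > of_int x \<Longrightarrow>
    field_rel G (Mul (Rho h l) (Delta g x)) (Mul (Delta g x) (Rho h l))"
| Rho_Rho_greater: "h1 \<in> carrier G \<Longrightarrow> h2 \<in> carrier G \<Longrightarrow> half l > half l' \<Longrightarrow>
    field_rel G (Mul (Rho h1 l) (Rho h2 l')) (Mul (Rho h2 l') (Rho (inv h2 \<otimes> h1 \<otimes> h2) l))"
| Rho_Rho_less: "h1 \<in> carrier G \<Longrightarrow> h2 \<in> carrier G \<Longrightarrow> half l < half l' \<Longrightarrow>
    field_rel G (Mul (Rho h1 l) (Rho h2 l')) (Mul (Rho (h1 \<otimes> h2 \<otimes> inv h1) l') (Rho h1 l))"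
| Delta_Star: "g \<in> carrier G \<Longrightarrow> field_rel G (Star (Delta g x)) (Delta g x)"
| Rho_Star: "h \<in> carrier G \<Longrightarrow> field_rel G (Star (Rho h l)) (Rho (inv h) l)"

primrec term_eval ::
    "('g \<Rightarrow> int \<Rightarrow> 'f) \<Rightarrow> ('g \<Rightarrow> int \<Rightarrow> 'f) \<Rightarrow> 'g field_term \<Rightarrow> 'f::cstar_algebra" where
  "term_eval \<delta> \<rho> (Delta g x) = \<delta> g x"
| "term_eval \<delta> \<rho> (Rho h l) = \<rho> h l"
| "term_eval \<delta> \<rho> One = 1"
| "term_eval \<delta> \<rho> (Scale c s) = c *\<^sub>C term_eval \<delta> \<rho> s"
| "term_eval \<delta> \<rho> (Add s t) = term_eval \<delta> \<rho> s + term_eval \<delta> \<rho> t"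
| "term_eval \<delta> \<rho> (Mul s t) = term_eval \<delta> \<rho> s * term_eval \<delta> \<rho> t"
| "term_eval \<delta> \<rho> (Star s) = star (term_eval \<delta> \<rho> s)"

definition local_field_algebra ::
    "('g, 'z) monoid_scheme \<Rightarrow> ('g \<Rightarrow> int \<Rightarrow> 'f) \<Rightarrow> ('g \<Rightarrow> int \<Rightarrow> 'f) \<Rightarrow> 'f::cstar_algebra set" where
  "local_field_algebra G \<delta> \<rho> = term_eval \<delta> \<rho> ` field_terms G"

text \<open>
  The $C^*$-algebra \<open>'f\<close> with the elements \<open>\<delta> g x\<close> and \<open>\<rho> h n\<close> (that is, $\rho_h(n+\frac12)$) is the
  $C^*$-completion of $\mathcal F_{\mathrm{loc}}$: it contains the $*$-algebra presented above
  (\<open>presentation\<close> gives the relations and, conversely, the injectivity of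
  $\mathcal F_{\mathrm{loc}}\to\mathcal F$) as a dense $*$-subalgebra. As $\mathcal F_{\mathrm{loc}}$
  is an increasing union of finite-dimensional $*$-algebras, its $C^*$-norm is unique, so this
  determines $\mathcal F$ up to isomorphism.
\<close>

locale field_algebra =
  fixes G :: "('g, 'z) monoid_scheme" (structure)
    and \<delta> \<rho> :: "'g \<Rightarrow> int \<Rightarrow> 'f::cstar_algebra"
  assumes presentation: "s \<in> field_terms G \<Longrightarrow> t \<in> field_terms G \<Longrightarrow>
      term_eval \<delta> \<rho> s = term_eval \<delta> \<rho> t \<longleftrightarrow> field_rel G s t"
    and dense: "closure (local_field_algebra G \<delta> \<rho>) = UNIV"

locale double_action =
  fixes G :: "('g, 'z) monoid_scheme" (structure)
    and \<delta> \<rho> :: "'g \<Rightarrow> int \<Rightarrow> 'f::cstar_algebra"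
    and act :: "'g \<times> 'g \<Rightarrow> 'f \<Rightarrow> 'f"
  assumes bounded: "a \<in> hbasis (quantum_double G) \<Longrightarrow> bounded_clinear (act a)"
    and act_delta: "g \<in> carrier G \<Longrightarrow> h \<in> carrier G \<Longrightarrow> f \<in> carrier G \<Longrightarrow>
      act (g, h) (\<delta> f x) = (if g = \<one> then \<delta> (h \<otimes> f) x else 0)"
    and act_rho: "g \<in> carrier G \<Longrightarrow> h \<in> carrier G \<Longrightarrow> t \<in> carrier G \<Longrightarrow>
      act (g, h) (\<rho> t l) = (if g = h \<otimes> t \<otimes> inv h then \<rho> g l else 0)"
    and act_mult: "a \<in> hbasis (quantum_double G) \<Longrightarrow>
      act a (T1 * T2) =
        (\<Sum>(p, q)\<in>hbasis (quantum_double G) \<times> hbasis (quantum_double G).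
          hcomult (quantum_double G) a (p, q) *\<^sub>C (act p T1 * act q T2))"


section \<open>Crossed products\<close>

text \<open>The element \<open>T \<otimes> I\<^sub>H\<close>, where \<open>tens T i\<close> is \<open>T \<otimes> i\<close>.\<close>

definition cp_incl ::
    "'i hopf_star_algebra \<Rightarrow> ('a \<Rightarrow> 'i \<Rightarrow> 'b) \<Rightarrow> 'a \<Rightarrow> 'b::cstar_algebra" where
  "cp_incl H tens T = (\<Sum>i\<in>hbasis H. hunit H i *\<^sub>C tens T i)"

text \<open>
  The $C^*$-algebra \<open>'b\<close> is the $C^*$-completion of the vector space \<open>A0 \<otimes> H\<close> with the crossed
  product structure, where \<open>A0\<close> is a dense $*$-subalgebra of the $C^*$-algebra \<open>'a\<close>, and
  \<open>tens T i\<close> is the elementary tensor \<open>T \<otimes> i\<close> with a basis element \<open>i\<close>, extended by continuity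
  from \<open>A0\<close> to all of \<open>'a\<close>. Elements of \<open>A0 \<otimes> H\<close> are families of elements of \<open>A0\<close> indexed
  by the basis.
\<close>

locale crossed_product =
  fixes H :: "'i hopf_star_algebra"
    and act :: "'i \<Rightarrow> 'a::cstar_algebra \<Rightarrow> 'a"
    and A0 :: "'a set"
    and tens :: "'a \<Rightarrow> 'i \<Rightarrow> 'b::cstar_algebra"
  assumes bounded: "i \<in> hbasis H \<Longrightarrow> bounded_clinear (\<lambda>T. tens T i)"
    and inj: "\<lbrakk>\<And>i. i \<in> hbasis H \<Longrightarrow> X i \<in> A0; (\<Sum>i\<in>hbasis H. tens (X i) i) = 0; i \<in> hbasis H\<rbrakk>
      \<Longrightarrow> X i = 0"
    and dense: "closure {\<Sum>i\<in>hbasis H. tens (X i) i | X. \<forall>i\<in>hbasis H. X i \<in> A0} = UNIV"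
    and unit: "cp_incl H tens 1 = 1"
    and mult: "T \<in> A0 \<Longrightarrow> F \<in> A0 \<Longrightarrow> a \<in> hbasis H \<Longrightarrow> b \<in> hbasis H \<Longrightarrow>
      tens T a * tens F b =
        (\<Sum>(p, q)\<in>hbasis H \<times> hbasis H. hcomult H a (p, q) *\<^sub>C
          (\<Sum>r\<in>hbasis H. hmult H q b r *\<^sub>C tens (T * act p F) r))"
    and star: "T \<in> A0 \<Longrightarrow> a \<in> hbasis H \<Longrightarrow>
      star (tens T a) = (\<Sum>r\<in>hbasis H. hstar H a r *\<^sub>C tens 1 r) * cp_incl H tens (star T)"

text \<open>The action of the dual of \<open>D(G)\<close> on the crossed product by \<open>D(G)\<close>.\<close>

locale dual_action =
  fixes G :: "('g, 'z) monoid_scheme" (structure)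
    and tens :: "'f::cstar_algebra \<Rightarrow> 'g \<times> 'g \<Rightarrow> 'c::cstar_algebra"
    and dact :: "'g \<times> 'g \<Rightarrow> 'c \<Rightarrow> 'c"
  assumes bounded: "a \<in> hbasis (dual_double G) \<Longrightarrow> bounded_clinear (dact a)"
    and dact_tens: "y \<in> carrier G \<Longrightarrow> x \<in> carrier G \<Longrightarrow> g \<in> carrier G \<Longrightarrow> h \<in> carrier G \<Longrightarrow>
      dact (y, x) (tens F (g, h)) = (if x = h then tens F (g \<otimes> inv y, h) else 0)"

definition cond_exp2 ::
    "('g, 'z) monoid_scheme \<Rightarrow> ('g \<times> 'g \<Rightarrow> 'c \<Rightarrow> 'c) \<Rightarrow> 'c \<Rightarrow> 'c::cstar_algebra" where
  "cond_exp2 G dact = lin_act (dual_double G) dact (dual_integral G)"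


section \<open>The $C^*$-basic construction\<close>

text \<open>
  Hilbert modules over a unital $C^*$-subalgebra \<open>A\<close> of \<open>'b\<close>, with right action \<open>rmul\<close> (relevant
  only for elements of \<open>A\<close>) and \<open>A\<close>-valued inner product \<open>ip\<close>. Completeness is the class \<open>banach\<close>;
  multiplication by a complex number \<open>c\<close> is \<open>rmul x (c *\<^sub>C 1)\<close>.
\<close>

locale hilbert_module =
  fixes A :: "'b::cstar_algebra set"
    and rmul :: "'m::banach \<Rightarrow> 'b \<Rightarrow> 'm"
    and ip :: "'m \<Rightarrow> 'm \<Rightarrow> 'b"
  assumes rmul_add_left: "a \<in> A \<Longrightarrow> rmul (x + y) a = rmul x a + rmul y a"
    and rmul_add_right: "a \<in> A \<Longrightarrow> b \<in> A \<Longrightarrow> rmul x (a + b) = rmul x a + rmul x b"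
    and rmul_mult: "a \<in> A \<Longrightarrow> b \<in> A \<Longrightarrow> rmul x (a * b) = rmul (rmul x a) b"
    and rmul_scaleR_one: "rmul x (r *\<^sub>R 1) = r *\<^sub>R x"
    and ip_in: "ip x y \<in> A"
    and ip_add_right: "ip x (y + z) = ip x y + ip x z"
    and ip_rmul_right: "a \<in> A \<Longrightarrow> ip x (rmul y a) = ip x y * a"
    and ip_star: "star (ip x y) = ip y x"
    and ip_positive: "\<exists>z\<in>A. ip x x = star z * z"
    and norm_ip: "norm x = sqrt (norm (ip x x))"

text \<open>
  The Hilbert \<open>A\<close>-module completion of \<open>'b\<close> for \<open>\<langle>x, y\<rangle> = \<Gamma> (star x * y)\<close>, with canonical map \<open>\<eta>\<close>.
\<close>

locale hilbert_module_completion = hilbert_module A rmul ip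
  for A :: "'b::cstar_algebra set" and rmul :: "'m::banach \<Rightarrow> 'b \<Rightarrow> 'm" and ip :: "'m \<Rightarrow> 'm \<Rightarrow> 'b" +
  fixes \<Gamma> :: "'b \<Rightarrow> 'b"
    and \<eta> :: "'b \<Rightarrow> 'm"
  assumes eta_add: "\<eta> (x + y) = \<eta> x + \<eta> y"
    and eta_mult: "a \<in> A \<Longrightarrow> \<eta> (x * a) = rmul (\<eta> x) a"
    and ip_eta: "ip (\<eta> x) (\<eta> y) = \<Gamma> (star x * y)"
    and dense: "closure (range \<eta>) = UNIV"

text \<open>The $C^*$-algebra of adjointable module maps; its norm is the operator norm of \<open>'m \<Rightarrow>\<^sub>L 'm\<close>.\<close>

definition adjointable_maps ::
    "'b set \<Rightarrow> ('m \<Rightarrow> 'b \<Rightarrow> 'm) \<Rightarrow> ('m \<Rightarrow> 'm \<Rightarrow> 'b) \<Rightarrow> ('m::banach \<Rightarrow>\<^sub>L 'm) set" where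
  "adjointable_maps A rmul ip =
    {T. (\<forall>x. \<forall>a\<in>A. blinfun_apply T (rmul x a) = rmul (blinfun_apply T x) a) \<and>
        (\<exists>S :: 'm \<Rightarrow>\<^sub>L 'm. \<forall>x y. ip (blinfun_apply T x) y = ip x (blinfun_apply S y))}"

definition left_mult ::
    "'b set \<Rightarrow> ('m \<Rightarrow> 'b \<Rightarrow> 'm) \<Rightarrow> ('m \<Rightarrow> 'm \<Rightarrow> 'b) \<Rightarrow> ('b \<Rightarrow> 'm) \<Rightarrow> 'b::cstar_algebra
      \<Rightarrow> ('m::banach \<Rightarrow>\<^sub>L 'm)" where
  "left_mult A rmul ip \<eta> b =
    (THE L. L \<in> adjointable_maps A rmul ip \<and> (\<forall>x. blinfun_apply L (\<eta> x) = \<eta> (b * x)))"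

definition jones_projection ::
    "'b set \<Rightarrow> ('m \<Rightarrow> 'b \<Rightarrow> 'm) \<Rightarrow> ('m \<Rightarrow> 'm \<Rightarrow> 'b) \<Rightarrow> ('b \<Rightarrow> 'b) \<Rightarrow> ('b \<Rightarrow> 'm)
      \<Rightarrow> ('m::banach \<Rightarrow>\<^sub>L 'm)" where
  "jones_projection A rmul ip \<Gamma> \<eta> =
    (THE e. e \<in> adjointable_maps A rmul ip \<and> (\<forall>x. blinfun_apply e (\<eta> x) = \<eta> (\<Gamma> x)))"

text \<open>
  The real \<open>span\<close> of the operators \<open>\<lambda>(x) \<gamma> \<lambda>(y)\<close> is their complex span, because this set of operators
  is stable under complex multiples (replace \<open>x\<close> by a multiple of \<open>x\<close>).
\<close>

definition basic_construction ::
    "'b set \<Rightarrow> ('m \<Rightarrow> 'b \<Rightarrow> 'm) \<Rightarrow> ('m \<Rightarrow> 'm \<Rightarrow> 'b) \<Rightarrow> ('b \<Rightarrow> 'b) \<Rightarrow> ('b::cstar_algebra \<Rightarrow> 'm)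
      \<Rightarrow> ('m::banach \<Rightarrow>\<^sub>L 'm) set" where
  "basic_construction A rmul ip \<Gamma> \<eta> =
    closure (span {left_mult A rmul ip \<eta> x o\<^sub>L jones_projection A rmul ip \<Gamma> \<eta> o\<^sub>L
                   left_mult A rmul ip \<eta> y | x y. True})"

text \<open>
  A $C^*$-isomorphism of the $C^*$-algebra \<open>'d\<close> onto a $C^*$-algebra \<open>S\<close> of adjointable operators. The
  fifth clause says that \<open>\<Phi> (star x)\<close> is the adjoint of \<open>\<Phi> x\<close>.
\<close>

definition cstar_isomorphism_onto ::
    "('m \<Rightarrow> 'b \<Rightarrow> 'm) \<Rightarrow> ('m \<Rightarrow> 'm \<Rightarrow> 'b::cstar_algebra) \<Rightarrow> ('m \<Rightarrow>\<^sub>L 'm) set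
      \<Rightarrow> ('d::cstar_algebra \<Rightarrow> ('m::banach \<Rightarrow>\<^sub>L 'm)) \<Rightarrow> bool" where
  "cstar_isomorphism_onto rmul ip S \<Phi> \<longleftrightarrow>
     bij_betw \<Phi> UNIV S \<and>
     (\<forall>x y. \<Phi> (x + y) = \<Phi> x + \<Phi> y) \<and>
     (\<forall>c x u. blinfun_apply (\<Phi> (c *\<^sub>C x)) u = rmul (blinfun_apply (\<Phi> x) u) (c *\<^sub>C 1)) \<and>
     (\<forall>x y. \<Phi> (x * y) = \<Phi> x o\<^sub>L \<Phi> y) \<and>
     (\<forall>x u v. ip (blinfun_apply (\<Phi> x) u) v = ip u (blinfun_apply (\<Phi> (star x)) v)) \<and>
     (\<forall>x. norm (\<Phi> x) = norm x)"

end

theory Submission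
  imports Defs "HOL-Library.Set_Algebras"
begin

text \<open>
  Write $B$ for the crossed product, $A = \mathcal F$, $E = E_2$, and
  $f = 1 \otimes E_2$ in the iterated crossed product. For $X \in B$ put $k(X) = X \otimes E_2$; then
  $k(X)^* k(Y) = k(E(X^* Y))$ and the range of $k$ is the left ideal generated by $f$. Since $k$ is
  isometric on $A$, it identifies the Hilbert module completion of $B$ with this left ideal in its
  $C^*$-norm, and the isomorphism is the left regular representation of the iterated crossed
  product on the ideal. The elements $u_i = 1 \otimes i$, for $i$ in the basis of $D(G)$, form a
  quasi-basis: $X = |G| \sum_i u_i E(u_i^* X)$ and $1 = |G| \sum_i u_i f u_i^*$. The first identity
  makes the range of $k$ closed; the second shows that the representation is bounded below and that
  its range is the span of the operators $\lambda(x) e_2 \lambda(y)$.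
\<close>

section \<open>Preliminaries on $C^*$-algebras and normed spaces\<close>

text \<open>The obstacle is that \<open>k\<close> is isometric on A. There it is multiplicative,
  since \<open>k a * k b = k (a * E b) = k (a * b)\<close>, and injective, so it behaves like an
  injective star-homomorphism of C*-algebras; its isometry is obtained without spectral theory. For
  self-adjoint \<open>h\<close> the norm of \<open>h ^ (2 ^ j)\<close> is the
  \<open>2 ^ j\<close>-th power of the norm of \<open>h\<close>, so two-sided bounds with constants
  independent of \<open>j\<close> already force equality of norms. The upper constant is the
  operator norm of \<open>k\<close>. The lower one needs a finite-dimensional space that contains
  all powers of \<open>h\<close>, which is why local finiteness is derived from the presentation;
  density then passes from the local algebra to A. Only after that does the quasi-basis bound
  \<open>k\<close> below on all of B. The same power argument makes the final isomorphism isometric,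
  with the lower constant now supplied by the quasi-basis.

  The factor |G| undoes the normalisation of the integral: the elements \<open>u_i\<close> are
  orthogonal for E, and each \<open>E (star u_i * u_i)\<close> equals 1/|G|.\<close>

lemma scaleC_zero_left [simp]: "0 *\<^sub>C (x :: 'a::cstar_algebra) = 0"
  using scaleC_of_real[of 0 x] by simp

lemma scaleC_one [simp]: "1 *\<^sub>C (x :: 'a::cstar_algebra) = x"
  using scaleC_of_real[of 1 x] by simp

lemma scaleC_zero_right [simp]: "c *\<^sub>C (0 :: 'a::cstar_algebra) = 0"
  using scaleC_add_right[of c 0 "0 :: 'a"] by simp

lemma scaleC_sum_right: "c *\<^sub>C sum f S = (\<Sum>i\<in>S. c *\<^sub>C (f i :: 'a::cstar_algebra))"
  by (induction S rule: infinite_finite_induct) (simp_all add: scaleC_add_right)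

lemma scaleC_sum_left: "sum f S *\<^sub>C (x :: 'a::cstar_algebra) = (\<Sum>i\<in>S. f i *\<^sub>C x)"
  by (induction S rule: infinite_finite_induct) (simp_all add: scaleC_add_left)

lemma scaleR_conv_scaleC: "r *\<^sub>R (x :: 'a::cstar_algebra) = complex_of_real r *\<^sub>C x"
  by (simp add: scaleC_of_real)

lemma bounded_clinear_scaleC: "bounded_clinear f \<Longrightarrow> f (c *\<^sub>C x) = c *\<^sub>C f x"
  by (simp add: bounded_clinear_def)

lemma bounded_clinear_linear: "bounded_clinear f \<Longrightarrow> bounded_linear f"
  by (simp add: bounded_clinear_def)

lemma bounded_clinear_scaleC_right: "bounded_clinear ((*\<^sub>C) c :: 'a::cstar_algebra \<Rightarrow> 'a)"
  unfolding bounded_clinear_def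
  by (auto intro!: bounded_linear_intro[of _ "cmod c"]
      simp: scaleC_add_right scaleR_conv_scaleC scaleC_scaleC norm_scaleC mult.commute)

lemma bounded_clinear_sum:
  "(\<And>i. i \<in> I \<Longrightarrow> bounded_clinear (f i)) \<Longrightarrow> bounded_clinear (\<lambda>x. \<Sum>i\<in>I. f i x)"
  unfolding bounded_clinear_def by (auto intro!: bounded_linear_sum simp: scaleC_sum_right)

lemma bounded_clinear_compose:
  "bounded_clinear f \<Longrightarrow> bounded_clinear g \<Longrightarrow> bounded_clinear (\<lambda>x. f (g x))"
  unfolding bounded_clinear_def using bounded_linear_compose by auto

lemma star_zero [simp]: "star (0 :: 'a::cstar_algebra) = 0"
  using star_add[of 0 "0 :: 'a"] by simp

lemma star_one [simp]: "star (1 :: 'a::cstar_algebra) = 1"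
  by (metis mult.left_neutral mult.right_neutral star_mult star_star)

lemma star_sum: "star (sum f S) = (\<Sum>i\<in>S. star (f i :: 'a::cstar_algebra))"
  by (induction S rule: infinite_finite_induct) (simp_all add: star_add)

lemma star_scaleR: "star (r *\<^sub>R x) = r *\<^sub>R star (x :: 'a::cstar_algebra)"
  by (simp add: scaleR_conv_scaleC star_scaleC)

lemma star_power: "star (x ^ n) = star (x :: 'a::cstar_algebra) ^ n"
  by (induction n) (simp_all add: star_mult power_commutes)

lemma norm_star [simp]: "norm (star x) = norm (x :: 'a::cstar_algebra)"
proof -
  have le: "norm y \<le> norm (star y)" for y :: 'a
  proof (cases "y = 0")
    case False
    have "norm y * norm y \<le> norm (star y) * norm y"
      using norm_mult_ineq[of "star y" y] by (simp add: cstar_identity power2_eq_square)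
    then show ?thesis using False by simp
  qed simp
  from le[of x] le[of "star x"] show ?thesis by (simp add: star_star)
qed

lemma bounded_linear_star: "bounded_linear (star :: 'a::cstar_algebra \<Rightarrow> 'a)"
  by (rule bounded_linear_intro[of _ 1]) (simp_all add: star_add star_scaleR)

text \<open>Each doubling is the C*-identity: \<open>h ^ (2 ^ Suc k)\<close> is
  \<open>star y * y\<close> for the self-adjoint \<open>y = h ^ (2 ^ k)\<close>.\<close>

lemma norm_selfadjoint_power:
  fixes h :: "'a::cstar_algebra"
  assumes "star h = h"
  shows "norm (h ^ (2 ^ k)) = norm h ^ (2 ^ k)"
proof (induction k)
  case (Suc k)
  have "norm (h ^ (2 ^ Suc k)) = norm (star (h ^ (2 ^ k)) * h ^ (2 ^ k))"
    by (simp add: star_power assms power_add mult_2)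
  also have "\<dots> = (norm h ^ (2 ^ k))\<^sup>2"
    by (simp add: cstar_identity Suc.IH)
  finally show ?case by (simp add: power_mult [symmetric] mult.commute)
qed simp

text \<open>If \<open>b < a\<close>, the powers of \<open>a / b\<close> outgrow every constant. This
  is the device that discards multiplicative constants from norm estimates.\<close>

lemma le_if_powers_le:
  fixes a b C :: real
  assumes "0 \<le> b" and le: "\<And>k. a ^ (2 ^ k) \<le> C * b ^ (2 ^ k)"
  shows "a \<le> b"
proof (rule ccontr)
  assume "\<not> a \<le> b"
  then have ab: "b < a" by simp
  show False
  proof (cases "b = 0")
    case True
    then show False using le[of 0] ab by simp
  next
    case False
    then have b: "0 < b" using assms by simp
    then have "1 < a / b" using ab by simp
    then obtain n where n: "C < (a / b) ^ n" using real_arch_pow by blast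
    have "(a / b) ^ n \<le> (a / b) ^ (2 ^ n)"
      using \<open>1 < a / b\<close> by (intro power_increasing) (simp_all add: less_imp_le)
    also have "\<dots> \<le> C"
      using le[of n] b by (simp add: power_divide divide_le_eq)
    finally show False using n by simp
  qed
qed

section \<open>Finite-dimensional subspaces of normed spaces\<close>

lemma scaled_infdist_le_norm_add:
  fixes s :: "'a::real_normed_vector"
  assumes w: "w \<in> span S"
  shows "\<bar>t\<bar> * infdist s (span S) \<le> norm (t *\<^sub>R s + w)"
proof (cases "t = 0")
  case False
  have m: "(- 1 / t) *\<^sub>R w \<in> span S" using w by (rule span_scale)
  have "\<bar>t\<bar> * infdist s (span S) \<le> \<bar>t\<bar> * dist s ((- 1 / t) *\<^sub>R w)"
    by (intro mult_left_mono infdist_le[OF m]) simp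
  also have "\<dots> = norm (t *\<^sub>R (s - (- 1 / t) *\<^sub>R w))"
    unfolding dist_norm norm_scaleR ..
  also have "t *\<^sub>R (s - (- 1 / t) *\<^sub>R w) = t *\<^sub>R s + w"
    using False by (simp add: scaleR_diff_right scaleR_add_right)
  finally show ?thesis .
qed simp

text \<open>Induction on the generators: the positive distance of a new vector \<open>s\<close> to
  the closed span of the others controls its coefficient, so along a convergent sequence these
  coefficients are Cauchy.\<close>

lemma closed_span_of_finite:
  fixes S :: "'a::real_normed_vector set"
  assumes "finite S"
  shows "closed (span S)"
  using assms
proof (induction S)
  case (insert s S)
  show ?case
  proof (cases "s \<in> span S")
    case True
    then show ?thesis using insert.IH by (simp add: span_redundant)
  next
    case False
    define d where "d = infdist s (span S)"
    have d: "0 < d"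
      unfolding d_def using insert.IH False span_zero
      by (metis empty_iff infdist_nonneg in_closed_iff_infdist_zero order_le_less)
    show ?thesis
      unfolding closed_sequential_limits
    proof (intro allI impI, elim conjE)
      fix x l
      assume x: "\<forall>n. x n \<in> span (insert s S)" and l: "x \<longlonglongrightarrow> l"
      have "\<forall>n. \<exists>t. x n - t *\<^sub>R s \<in> span S" using x by (simp add: span_insert)
      then obtain t where t: "\<And>n. x n - t n *\<^sub>R s \<in> span S" by metis
      have t_le: "\<bar>t m - t n\<bar> * d \<le> norm (x m - x n)" for m n
      proof -
        have "(x m - t m *\<^sub>R s) - (x n - t n *\<^sub>R s) \<in> span S" by (intro span_diff t)
        from scaled_infdist_le_norm_add[OF this, of "t m - t n" s] show ?thesis
          by (simp add: d_def algebra_simps)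
      qed
      have "Cauchy t"
      proof (rule metric_CauchyI)
        fix e :: real assume "0 < e"
        then have "0 < e * d" using d by simp
        then obtain M where M: "\<And>m n. m \<ge> M \<Longrightarrow> n \<ge> M \<Longrightarrow> dist (x m) (x n) < e * d"
          using LIMSEQ_imp_Cauchy[OF l] by (meson metric_CauchyD)
        show "\<exists>M. \<forall>m\<ge>M. \<forall>n\<ge>M. dist (t m) (t n) < e"
        proof (intro exI allI impI)
          fix m n assume "m \<ge> M" "n \<ge> M"
          then have "\<bar>t m - t n\<bar> * d < e * d"
            using M[of m n] t_le[of m n] by (simp add: dist_norm)
          then show "dist (t m) (t n) < e" using d by (simp add: dist_real_def)
        qed
      qed
      then obtain T where T: "t \<longlonglongrightarrow> T"
        using Cauchy_convergent convergent_def by blast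
      have "(\<lambda>n. x n - t n *\<^sub>R s) \<longlonglongrightarrow> l - T *\<^sub>R s"
        by (intro tendsto_intros l T)
      then have "l - T *\<^sub>R s \<in> span S"
        by (rule closed_sequentially[OF insert.IH t])
      then show "l \<in> span (insert s S)" by (auto simp: span_insert)
    qed
  qed
qed simp

text \<open>The same coefficient control, now in the codomain: \<open>f s\<close> has positive
  distance to the span of the other images, because that span is closed and \<open>f\<close> is
  injective on \<open>span (insert s S)\<close>.\<close>

lemma linear_injective_on_span_bounded_below:
  fixes f :: "'a::real_normed_vector \<Rightarrow> 'b::real_normed_vector"
  assumes "finite S" and f: "linear f" and inj: "\<And>x. x \<in> span S \<Longrightarrow> f x = 0 \<Longrightarrow> x = 0"
  shows "\<exists>c\<ge>0. \<forall>x\<in>span S. norm x \<le> c * norm (f x)"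
  using assms(1) inj
proof (induction S)
  case (insert s S)
  interpret f: linear f by fact
  have sub: "span S \<subseteq> span (insert s S)" by (simp add: span_mono subset_insertI)
  then obtain c where c: "c \<ge> 0" "\<And>x. x \<in> span S \<Longrightarrow> norm x \<le> c * norm (f x)"
    using insert by blast
  show ?case
  proof (cases "s \<in> span S")
    case True
    then show ?thesis using c by (auto simp: span_redundant)
  next
    case False
    define d where "d = infdist (f s) (span (f ` S))"
    have "f s \<notin> span (f ` S)"
    proof
      assume "f s \<in> span (f ` S)"
      then obtain w where w: "w \<in> span S" "f s = f w"
        using linear_span_image[OF f, of S] by auto
      then have "s - w \<in> span (insert s S)"
        by (meson span_base span_diff insertI1 sub subsetD)
      then have "s - w = 0" using w by (intro insert.prems) (simp_all add: f.diff)
      then show False using w False by simp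
    qed
    then have d: "0 < d"
      unfolding d_def using closed_span_of_finite[of "f ` S"] insert.hyps span_zero
      by (metis empty_iff finite_imageI infdist_nonneg in_closed_iff_infdist_zero order_le_less)
    \<comment> \<open>\<open>norm (f x) / d\<close> will bound the coefficient \<open>t\<close> of
      \<open>s\<close>; the first summand accounts for the part along \<open>s\<close>, the second,
      through the induction constant \<open>c\<close>, for the remainder.\<close>
    let ?C = "norm s / d + c * (1 + norm (f s) / d)"
    show ?thesis
    proof (intro exI[of _ ?C] conjI ballI)
      show "0 \<le> ?C" using c d by simp
      fix x assume "x \<in> span (insert s S)"
      then obtain t where t: "x - t *\<^sub>R s \<in> span S" by (auto simp: span_insert)
      let ?w = "x - t *\<^sub>R s"
      have "f ?w \<in> span (f ` S)" using t linear_span_image[OF f, of S] by auto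
      from scaled_infdist_le_norm_add[OF this, of t "f s"]
      have "\<bar>t\<bar> * d \<le> norm (f x)" by (simp add: d_def f.diff f.scale)
      then have t_le: "\<bar>t\<bar> \<le> norm (f x) / d" using d by (simp add: pos_le_divide_eq)
      have "norm (f ?w) \<le> norm (f x) + \<bar>t\<bar> * norm (f s)"
        by (metis f.diff f.scale norm_scaleR norm_triangle_ineq4)
      also have "\<dots> \<le> norm (f x) + norm (f x) / d * norm (f s)"
        by (intro add_left_mono mult_right_mono t_le) simp
      finally have w: "norm ?w \<le> c * (norm (f x) + norm (f x) / d * norm (f s))"
        using c(1) c(2)[OF t] by (meson mult_left_mono order_trans)
      have "norm x \<le> \<bar>t\<bar> * norm s + norm ?w"
        by (metis add.commute diff_add_cancel norm_scaleR norm_triangle_ineq)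
      also have "\<dots> \<le> norm (f x) / d * norm s + c * (norm (f x) + norm (f x) / d * norm (f s))"
        by (intro add_mono mult_right_mono t_le w) simp
      finally show "norm x \<le> ?C * norm (f x)" by (simp add: algebra_simps)
    qed
  qed
qed auto

lemma closed_range_if_bounded_below:
  fixes f :: "'a::banach \<Rightarrow> 'b::banach"
  assumes f: "bounded_linear f" and le: "\<And>x. norm x \<le> C * norm (f x)"
  shows "closed (range f)"
proof -
  have "complete (range f)"
  proof (rule complete_isometric_image[OF _ subspace_UNIV f])
    \<comment> \<open>\<open>C\<close> may be zero or negative, so the positive constant
      \<open>\<bar>C\<bar> + 1\<close> takes its place.\<close>
    show "0 < 1 / (\<bar>C\<bar> + 1)" by simp
    have "norm x \<le> (\<bar>C\<bar> + 1) * norm (f x)" for x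
      by (rule order_trans[OF le mult_right_mono]) auto
    then show "\<forall>x\<in>UNIV. 1 / (\<bar>C\<bar> + 1) * norm x \<le> norm (f x)"
      by (auto simp: pos_divide_le_eq mult.commute add_nonneg_pos)
  qed (simp add: complete_UNIV)
  then show ?thesis by (rule complete_imp_closed)
qed

section \<open>The basic construction from a left ideal\<close>

context hilbert_module_completion
begin

text \<open>Pairing with \<open>\<eta> 1\<close> recovers the expectation,
  \<open>\<Gamma> x = ip (\<eta> 1) (\<eta> x)\<close>, so its properties can be read off the inner
  product axioms.\<close>

lemma expectation_in: "\<Gamma> x \<in> A"
  using ip_in[of "\<eta> 1" "\<eta> x"] by (simp add: ip_eta)

lemma expectation_mult_right: "a \<in> A \<Longrightarrow> \<Gamma> (x * a) = \<Gamma> x * a"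
  using ip_rmul_right[of a "\<eta> 1" "\<eta> x"] by (simp add: eta_mult [symmetric] ip_eta)

lemma expectation_star: "\<Gamma> (star x) = star (\<Gamma> x)"
  using ip_star[of "\<eta> 1" "\<eta> x"] by (simp add: ip_eta)

end

text \<open>Abstracts the iterated crossed product: \<open>J\<close> is the embedding of B, and
  \<open>v\<close>, \<open>v'\<close> are the two halves of the quasi-basis.
  \<open>left_ideal\<close> speaks of a dense set of \<open>T\<close> because explicit formulas
  exist only for finite sums of elementary tensors.\<close>

locale basic_construction_model = hilbert_module_completion A rmul ip E \<eta>
  for A :: "'b::cstar_algebra set" and rmul :: "'m::banach \<Rightarrow> 'b \<Rightarrow> 'm"
    and ip :: "'m \<Rightarrow> 'm \<Rightarrow> 'b" and E :: "'b \<Rightarrow> 'b" and \<eta> :: "'b \<Rightarrow> 'm" +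
  fixes k J :: "'b \<Rightarrow> 'd::cstar_algebra"
    and I :: "'i set" and v v' :: "'i \<Rightarrow> 'b"
  assumes E_clinear: "bounded_clinear E"
    and E_fixes: "a \<in> A \<Longrightarrow> E a = a"
    and one_in: "1 \<in> A"
    and k_clinear: "bounded_clinear k"
    and J_k: "J c * k x = k (c * x)"
    and k_k: "k x * k y = k (x * E y)"
    and star_k: "star (k x) * k y = k (E (star x * y))"
    and left_ideal: "closure {T. \<forall>x. T * k x \<in> range k} = UNIV"
    and k_J: "(\<Sum>i\<in>I. k (v i) * J (v' i)) = 1"
    and quasi_basis: "(\<Sum>i\<in>I. v i * E (v' i * x)) = x"
    and norm_k: "a \<in> A \<Longrightarrow> norm (k a) = norm a"
begin

lemmas E_scaleC = bounded_clinear_scaleC[OF E_clinear]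
lemmas k_scaleC = bounded_clinear_scaleC[OF k_clinear]

interpretation k: bounded_linear k by (rule bounded_clinear_linear[OF k_clinear])
interpretation E: bounded_linear E by (rule bounded_clinear_linear[OF E_clinear])

lemmas E_in = expectation_in
lemmas E_mult_right = expectation_mult_right
lemmas E_star = expectation_star

lemma in_A_iff: "a \<in> A \<longleftrightarrow> E a = a"
  using E_in[of a] E_fixes by auto

text \<open>The right-hand version applied to adjoints. \<open>A\<close> is stable under
  \<open>star\<close>, being the fixed-point set of \<open>E\<close>, which commutes with
  \<open>star\<close>.\<close>

lemma E_mult_left: "a \<in> A \<Longrightarrow> E (a * x) = a * E x"
  using E_mult_right[of "star a" "star x"] E_star[of a] E_star[of x] E_star[of "a * x"]
  by (metis in_A_iff star_mult star_star)

lemma scaleC_one_in: "c *\<^sub>C 1 \<in> A"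
  using one_in by (simp add: in_A_iff E_scaleC)

text \<open>Both squares equal the norm of \<open>E (star x * x)\<close>: one by the definition of
  the inner product, the other by the C*-identity for \<open>k x\<close> and isometry of
  \<open>k\<close> on \<open>A\<close>.\<close>

lemma norm_eta: "norm (\<eta> x) = norm (k x)"
proof -
  have "norm (\<eta> x) = sqrt (norm (k (E (star x * x))))"
    by (simp add: norm_ip[of "\<eta> x"] ip_eta norm_k E_in)
  also have "\<dots> = norm (k x)" by (simp add: star_k [symmetric] cstar_identity)
  finally show ?thesis .
qed

lemma eta_scaleC: "\<eta> (c *\<^sub>C x) = rmul (\<eta> x) (c *\<^sub>C 1)"
  using eta_mult[OF scaleC_one_in, of x c] by (simp add: mult_scaleC_right)

lemma bounded_linear_eta: "bounded_linear \<eta>"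
proof (rule bounded_linear_intro)
  show "\<eta> (r *\<^sub>R x) = r *\<^sub>R \<eta> x" for r x
    using eta_scaleC[of "complex_of_real r" x] by (simp add: scaleC_of_real rmul_scaleR_one)
  show "norm (\<eta> x) \<le> norm x * onorm k" for x
    by (simp add: norm_eta onorm[OF k.bounded_linear] mult.commute)
qed (rule eta_add)

interpretation \<eta>: bounded_linear \<eta> by (rule bounded_linear_eta)

lemma k_bounded_below: "\<exists>C\<ge>0. \<forall>x. norm x \<le> C * norm (k x)"
proof (intro exI conjI allI)
  let ?C = "\<Sum>i\<in>I. norm (v i) * norm (k 1 * J (v' i))"
  show "0 \<le> ?C" by (intro sum_nonneg mult_nonneg_nonneg) auto
  fix x
  \<comment> \<open>The coefficient lies in \<open>A\<close>, where \<open>k\<close> preserves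
    norms, and its image under \<open>k\<close> is \<open>k 1 * J (v' i) * k x\<close>: it depends
    on \<open>x\<close> only through \<open>k x\<close>.\<close>
  have le: "norm (E (v' i * x)) \<le> norm (k 1 * J (v' i)) * norm (k x)" for i
  proof -
    have "norm (E (v' i * x)) = norm (k 1 * J (v' i) * k x)"
      by (simp add: mult.assoc J_k k_k norm_k E_in)
    also have "\<dots> \<le> norm (k 1 * J (v' i)) * norm (k x)" by (rule norm_mult_ineq)
    finally show ?thesis .
  qed
  have "norm x = norm (\<Sum>i\<in>I. v i * E (v' i * x))" by (simp add: quasi_basis)
  also have "\<dots> \<le> (\<Sum>i\<in>I. norm (v i) * (norm (k 1 * J (v' i)) * norm (k x)))"
    by (intro sum_norm_le order_trans[OF norm_mult_ineq] mult_left_mono le) auto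
  finally show "norm x \<le> ?C * norm (k x)" by (simp add: sum_distrib_right mult.assoc)
qed

lemma inj_k: "inj k"
proof -
  obtain C where C: "\<And>x. norm x \<le> C * norm (k x)" using k_bounded_below by blast
  show ?thesis
  proof (rule injI)
    fix x y assume "k x = k y"
    then show "x = y" using C[of "x - y"] by (simp add: k.diff)
  qed
qed

lemma inj_eta: "inj \<eta>"
proof (rule injI)
  fix x y assume "\<eta> x = \<eta> y"
  then have "norm (k (x - y)) = 0" by (simp add: norm_eta [symmetric] \<eta>.diff)
  then show "x = y" using inj_k by (simp add: k.diff inj_eq)
qed

text \<open>By \<open>norm_eta\<close> the lower bound for \<open>k\<close> is one for
  \<open>\<eta>\<close>, so the dense range of \<open>\<eta>\<close> is closed: the completion adds
  no points.\<close>

lemma surj_eta: "surj \<eta>"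
  using k_bounded_below closed_range_if_bounded_below[OF bounded_linear_eta] dense
  by (metis closure_closed norm_eta)

text \<open>\<open>range k\<close> is closed, so the condition on \<open>T\<close> is a closed one
  and extends from the dense set in \<open>left_ideal\<close> to all \<open>T\<close>.\<close>

lemma mult_k_in_range: "T * k x \<in> range k"
proof -
  have "closed (range k)"
    using k_bounded_below closed_range_if_bounded_below[OF k.bounded_linear] by metis
  then have "closed {T. \<forall>x. T * k x \<in> range k}"
    unfolding Collect_all_eq
    by (intro closed_INT ballI closed_vimage[of _ "\<lambda>T. T * k _", unfolded vimage_def])
      (auto intro!: continuous_intros)
  then show ?thesis using left_ideal by (simp add: closure_closed set_eq_iff)
qed

section \<open>The left regular representation on \<open>range k\<close>, pulled back to
  \<open>'b\<close>\<close>

definition Psi :: "'d \<Rightarrow> 'b \<Rightarrow> 'b" where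
  "Psi T x = inv_into UNIV k (T * k x)"

lemma k_Psi: "k (Psi T x) = T * k x"
  unfolding Psi_def by (rule f_inv_into_f[OF mult_k_in_range])

lemma Psi_eqI: "T * k x = k y \<Longrightarrow> Psi T x = y"
  unfolding Psi_def using inj_k by simp

lemma Psi_mult: "Psi (S * T) x = Psi S (Psi T x)"
  by (rule Psi_eqI) (simp add: k_Psi mult.assoc)

text \<open>Under the injective \<open>k\<close> both sides become
  \<open>star (k x) * star T * k y\<close>.\<close>

lemma Psi_adjoint: "E (star (Psi T x) * y) = E (star x * Psi (star T) y)"
proof -
  have "k (E (star (Psi T x) * y)) = star (T * k x) * k y"
    by (simp add: star_k [symmetric] k_Psi)
  also have "\<dots> = k (E (star x * Psi (star T) y))"
    by (simp add: star_mult star_k [symmetric] k_Psi mult.assoc)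
  finally show ?thesis using inj_k by (simp add: inj_eq)
qed

lemma Psi_add_left: "Psi (S + T) x = Psi S x + Psi T x"
  by (rule Psi_eqI) (simp add: k.add k_Psi distrib_right)

lemma Psi_scaleC_left: "Psi (c *\<^sub>C T) x = c *\<^sub>C Psi T x"
  by (rule Psi_eqI) (simp add: k_scaleC k_Psi mult_scaleC_left)

lemma bounded_linear_Psi: "bounded_linear (Psi T)"
proof -
  obtain C where C: "0 \<le> C" "\<And>x. norm x \<le> C * norm (k x)" using k_bounded_below by blast
  show ?thesis
  proof (rule bounded_linear_intro)
    show "Psi T (x + y) = Psi T x + Psi T y" for x y
      by (rule Psi_eqI) (simp add: k.add k_Psi distrib_left)
    show "Psi T (r *\<^sub>R x) = r *\<^sub>R Psi T x" for r x
      by (rule Psi_eqI) (simp add: k.scale k_Psi)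
    fix x
    have "norm (Psi T x) \<le> C * norm (T * k x)" using C(2)[of "Psi T x"] by (simp add: k_Psi)
    also have "\<dots> \<le> C * (norm T * (onorm k * norm x))"
      using C(1) by (intro mult_left_mono order_trans[OF norm_mult_ineq] onorm
          k.bounded_linear) auto
    finally show "norm (Psi T x) \<le> norm x * (C * norm T * onorm k)" by (simp add: mult_ac)
  qed
qed

section \<open>Operators on \<open>'b\<close> carried over to the Hilbert module\<close>

lemma bounded_linear_inv_eta: "bounded_linear (inv_into UNIV \<eta>)"
proof -
  obtain C where C: "\<And>x. norm x \<le> C * norm (k x)" using k_bounded_below by blast
  have \<eta>_inv: "\<eta> (inv_into UNIV \<eta> u) = u" for u by (simp add: surj_eta surj_f_inv_f)
  have inv_eqI: "\<eta> x = u \<Longrightarrow> inv_into UNIV \<eta> u = x" for x u using inj_eta by auto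
  show ?thesis
  proof (rule bounded_linear_intro)
    show "inv_into UNIV \<eta> (u + w) = inv_into UNIV \<eta> u + inv_into UNIV \<eta> w" for u w
      by (rule inv_eqI) (simp add: \<eta>.add \<eta>_inv)
    show "inv_into UNIV \<eta> (r *\<^sub>R u) = r *\<^sub>R inv_into UNIV \<eta> u" for r u
      by (rule inv_eqI) (simp add: \<eta>.scale \<eta>_inv)
    show "norm (inv_into UNIV \<eta> u) \<le> norm u * C" for u
      using C[of "inv_into UNIV \<eta> u"] by (simp add: norm_eta [symmetric] \<eta>_inv mult.commute)
  qed
qed

text \<open>Conjugation by the bounded bijection \<open>\<eta>\<close>. \<open>Blinfun\<close> is
  meaningful only for bounded linear maps, whence the premise on \<open>P\<close> in the facts
  below.\<close>

definition transport :: "('b \<Rightarrow> 'b) \<Rightarrow> ('m \<Rightarrow>\<^sub>L 'm)" where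
  "transport P = Blinfun (\<lambda>u. \<eta> (P (inv_into UNIV \<eta> u)))"

lemma transport_eta: "bounded_linear P \<Longrightarrow> blinfun_apply (transport P) (\<eta> x) = \<eta> (P x)"
  unfolding transport_def using inj_eta
  by (subst bounded_linear_Blinfun_apply)
    (auto intro!: bounded_linear_compose[OF bounded_linear_eta]
      bounded_linear_compose[OF _ bounded_linear_inv_eta])

lemma transport_unique:
  "bounded_linear P \<Longrightarrow> (\<And>x. blinfun_apply L (\<eta> x) = \<eta> (P x)) \<Longrightarrow> L = transport P"
  by (rule blinfun_eqI) (metis surjD surj_eta transport_eta)

lemma transport_adjointable:
  assumes P: "bounded_linear P" and Q: "bounded_linear Q"
    and lin: "\<And>x a. a \<in> A \<Longrightarrow> P (x * a) = P x * a"
    and adj: "\<And>x y. E (star (P x) * y) = E (star x * Q y)"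
  shows "transport P \<in> adjointable_maps A rmul ip"
  unfolding adjointable_maps_def
proof (intro CollectI conjI allI ballI exI)
  fix u w a
  obtain x y where [simp]: "u = \<eta> x" "w = \<eta> y" using surj_eta by (metis surjD)
  show "blinfun_apply (transport P) (rmul u a) = rmul (blinfun_apply (transport P) u) a"
    if "a \<in> A" using that by (simp add: eta_mult [symmetric] transport_eta P lin)
  show "ip (blinfun_apply (transport P) u) w = ip u (blinfun_apply (transport Q) w)"
    by (simp add: transport_eta P Q ip_eta adj)
qed

text \<open>Surjectivity of \<open>\<eta>\<close> makes the definite description unique; the adjoint
  is multiplication by \<open>star b\<close>.\<close>

lemma left_mult_eq: "left_mult A rmul ip \<eta> b = transport ((*) b)"
  unfolding left_mult_def
proof (rule the_equality)
  show "transport ((*) b) \<in> adjointable_maps A rmul ip \<and>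
      (\<forall>x. blinfun_apply (transport ((*) b)) (\<eta> x) = \<eta> (b * x))"
    by (intro conjI allI transport_adjointable[where Q = "(*) (star b)"] transport_eta
        bounded_linear_mult_right) (simp_all add: star_mult mult.assoc)
qed (auto intro: transport_unique bounded_linear_mult_right)

text \<open>\<open>E\<close> is its own adjoint: by bimodularity both
  \<open>E (star (E x) * y)\<close> and \<open>E (star x * E y)\<close> equal
  \<open>star (E x) * E y\<close>.\<close>

lemma jones_projection_eq: "jones_projection A rmul ip E \<eta> = transport E"
  unfolding jones_projection_def
proof (rule the_equality)
  show "transport E \<in> adjointable_maps A rmul ip \<and>
      (\<forall>x. blinfun_apply (transport E) (\<eta> x) = \<eta> (E x))"
    by (intro conjI allI transport_adjointable[where Q = E] transport_eta E.bounded_linear)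
      (simp_all add: E_mult_right E_mult_left E_star [symmetric] E_in)
qed (auto intro: transport_unique E.bounded_linear)

definition Phi :: "'d \<Rightarrow> ('m \<Rightarrow>\<^sub>L 'm)" where
  "Phi T = transport (Psi T)"

lemma Phi_eta: "blinfun_apply (Phi T) (\<eta> x) = \<eta> (Psi T x)"
  unfolding Phi_def by (rule transport_eta[OF bounded_linear_Psi])

lemma Phi_eqI: "(\<And>x. blinfun_apply L (\<eta> x) = \<eta> (Psi T x)) \<Longrightarrow> Phi T = L"
  unfolding Phi_def by (rule transport_unique[OF bounded_linear_Psi, symmetric])

lemma Phi_add: "Phi (S + T) = Phi S + Phi T"
  by (rule Phi_eqI) (simp add: blinfun.add_left Phi_eta Psi_add_left \<eta>.add)

lemma Phi_mult: "Phi (S * T) = Phi S o\<^sub>L Phi T"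
  by (rule Phi_eqI) (simp add: Phi_eta Psi_mult)

lemma Phi_scaleC: "blinfun_apply (Phi (c *\<^sub>C T)) u = rmul (blinfun_apply (Phi T) u) (c *\<^sub>C 1)"
  using surj_eta by (metis Phi_eta Psi_scaleC_left eta_scaleC surjD)

lemma linear_Phi: "linear Phi"
proof (rule linearI)
  show "Phi (r *\<^sub>R T) = r *\<^sub>R Phi T" for r T
    using Phi_scaleC[of "complex_of_real r" T]
    by (intro blinfun_eqI) (simp add: scaleC_of_real blinfun.scaleR_left rmul_scaleR_one)
qed (rule Phi_add)

lemma Phi_adjoint: "ip (blinfun_apply (Phi T) u) w = ip u (blinfun_apply (Phi (star T)) w)"
  using surj_eta by (metis Phi_eta Psi_adjoint ip_eta surjD)

lemma norm_Phi_le: "norm (Phi T) \<le> norm T"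
proof (rule norm_blinfun_bound)
  fix u obtain x where [simp]: "u = \<eta> x" using surj_eta by (metis surjD)
  show "norm (blinfun_apply (Phi T) u) \<le> norm T * norm u"
    by (simp add: Phi_eta norm_eta k_Psi norm_mult_ineq)
qed simp

text \<open>Multiplying \<open>k_J\<close> by \<open>T\<close> writes \<open>T\<close> through the
  elements \<open>T * k (v i)\<close>, whose norms are those of \<open>Phi T\<close> at the vectors
  \<open>\<eta> (v i)\<close>.\<close>

lemma Phi_bounded_below: "\<exists>C. \<forall>T. norm T \<le> C * norm (Phi T)"
proof -
  let ?C = "\<Sum>i\<in>I. norm (k (v i)) * norm (J (v' i))"
  have "norm T \<le> ?C * norm (Phi T)" for T
  proof -
  have "norm T = norm (\<Sum>i\<in>I. T * k (v i) * J (v' i))"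
    by (simp add: mult.assoc sum_distrib_left [symmetric] k_J)
  also have "\<dots> \<le> (\<Sum>i\<in>I. norm (Phi T) * norm (k (v i)) * norm (J (v' i)))"
  proof (rule sum_norm_le)
    fix i
    have "norm (T * k (v i)) = norm (blinfun_apply (Phi T) (\<eta> (v i)))"
      by (simp add: Phi_eta norm_eta k_Psi)
    also have "\<dots> \<le> norm (Phi T) * norm (\<eta> (v i))" by (rule norm_blinfun)
    finally have "norm (T * k (v i)) \<le> norm (Phi T) * norm (k (v i))" by (simp add: norm_eta)
    then show "norm (T * k (v i) * J (v' i)) \<le> norm (Phi T) * norm (k (v i)) * norm (J (v' i))"
      by (rule order_trans[OF norm_mult_ineq mult_right_mono[OF _ norm_ge_zero]])
  qed
  finally show "norm T \<le> ?C * norm (Phi T)"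
    by (simp add: sum_distrib_left mult_ac)
  qed
  then show ?thesis by blast
qed

lemma Phi_power_le:
  assumes "0 < n"
  shows "norm (Phi (T ^ n)) \<le> norm (Phi T) ^ n"
  using assms
proof (induction n rule: nat_induct_non_zero)
  case (Suc n)
  have "norm (Phi (T ^ Suc n)) \<le> norm (Phi T) * norm (Phi (T ^ n))"
    by (simp add: Phi_mult norm_blinfun_compose)
  also have "\<dots> \<le> norm (Phi T) * norm (Phi T) ^ n" using Suc by (intro mult_left_mono) auto
  finally show ?case by simp
qed simp

text \<open>
  A bi-bounded \<open>*\<close>-homomorphism is isometric, because the norm of a self-adjoint \<open>h\<close> is the limit
  of \<open>norm (h ^ (2 ^ n))\<close> to the power \<open>1 / 2 ^ n\<close>, which does not see multiplicative constants.
\<close>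

lemma norm_Phi: "norm (Phi T) = norm T"
proof (rule antisym[OF norm_Phi_le])
  obtain C where C: "\<And>T. norm T \<le> C * norm (Phi T)" using Phi_bounded_below by blast
  let ?h = "star T * T"
  have "norm ?h \<le> norm (Phi ?h)"
  proof (rule le_if_powers_le)
    fix n
    have "0 \<le> C" using C[of 1] norm_ge_zero[of "Phi 1"]
      by (metis mult_nonpos_nonneg not_one_le_zero norm_one order_trans linear)
    have "norm ?h ^ (2 ^ n) = norm (?h ^ (2 ^ n))"
      by (rule norm_selfadjoint_power [symmetric]) (simp add: star_mult star_star)
    also have "\<dots> \<le> C * norm (Phi (?h ^ (2 ^ n)))" by (rule C)
    also have "\<dots> \<le> C * norm (Phi ?h) ^ (2 ^ n)"
      using \<open>0 \<le> C\<close> by (intro mult_left_mono Phi_power_le) auto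
    finally show "norm ?h ^ (2 ^ n) \<le> C * norm (Phi ?h) ^ (2 ^ n)" .
  qed simp
  also have "\<dots> \<le> norm (Phi (star T)) * norm (Phi T)"
    by (simp add: Phi_mult norm_blinfun_compose)
  also have "\<dots> \<le> norm T * norm (Phi T)"
    using norm_Phi_le[of "star T"] by (intro mult_right_mono) auto
  finally have le: "norm T * norm T \<le> norm T * norm (Phi T)"
    by (simp add: cstar_identity power2_eq_square)
  show "norm T \<le> norm (Phi T)"
  proof (cases "T = 0")
    case False
    then show ?thesis using le by simp
  qed simp
qed

text \<open>Both operators send \<open>\<eta> z\<close> to \<open>\<eta> (x * E (y * z))\<close>.
  Hence every generator of the basic construction is in the range of \<open>Phi\<close>.\<close>

lemma Phi_k_J:
  "Phi (k x * J y) = left_mult A rmul ip \<eta> x o\<^sub>L jones_projection A rmul ip E \<eta> o\<^sub>L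
     left_mult A rmul ip \<eta> y"
proof (rule Phi_eqI)
  fix z
  have "Psi (k x * J y) z = x * E (y * z)"
    by (rule Psi_eqI) (simp add: mult.assoc J_k k_k)
  then show "blinfun_apply (left_mult A rmul ip \<eta> x o\<^sub>L jones_projection A rmul ip E \<eta> o\<^sub>L
      left_mult A rmul ip \<eta> y) (\<eta> z) = \<eta> (Psi (k x * J y) z)"
    by (simp add: left_mult_eq jones_projection_eq transport_eta bounded_linear_mult_right
        E.bounded_linear)
qed

lemma range_Phi: "range Phi = basic_construction A rmul ip E \<eta>"
proof -
  let ?S = "{left_mult A rmul ip \<eta> x o\<^sub>L jones_projection A rmul ip E \<eta> o\<^sub>L
     left_mult A rmul ip \<eta> y | x y. True}"
  interpret Phi: linear Phi by (rule linear_Phi)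
  have bl: "bounded_linear Phi"
    by (rule bounded_linear_intro[of _ 1]) (simp_all add: Phi.add Phi.scale norm_Phi)
  have "range Phi \<subseteq> span ?S"
  proof
    fix L assume "L \<in> range Phi"
    then obtain T where T: "L = Phi T" by blast
    \<comment> \<open>Since \<open>T * k (v i)\<close> is again a value of \<open>k\<close>, the
      identity \<open>k_J\<close> displays every \<open>T\<close> as a finite sum of products
      \<open>k x * J y\<close>; so the span is reached before taking the closure.\<close>
    have "T = (\<Sum>i\<in>I. k (Psi T (v i)) * J (v' i))"
      by (simp add: k_Psi mult.assoc sum_distrib_left [symmetric] k_J)
    then have "L = (\<Sum>i\<in>I. Phi (k (Psi T (v i)) * J (v' i)))"
      unfolding T by (metis Phi.sum)
    also have "\<dots> \<in> span ?S" unfolding Phi_k_J by (intro span_sum span_base) blast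
    finally show "L \<in> span ?S" .
  qed
  moreover have "span ?S \<subseteq> range Phi"
  proof (rule span_minimal)
    show "?S \<subseteq> range Phi" unfolding Phi_k_J [symmetric] by blast
    show "subspace (range Phi)"
      using linear_subspace_image[OF linear_Phi subspace_UNIV] .
  qed
  ultimately have "span ?S = range Phi" by blast
  moreover have "closed (range Phi)"
    by (rule closed_range_if_bounded_below[OF bl, of 1]) (simp add: norm_Phi)
  ultimately show ?thesis by (simp add: basic_construction_def closure_closed)
qed

theorem cstar_isomorphism_Phi:
  "cstar_isomorphism_onto rmul ip (basic_construction A rmul ip E \<eta>) Phi"
proof -
  have "inj Phi"
  proof (rule injI)
    fix S T assume "Phi S = Phi T"
    then have "norm (S - T) = 0"
      using linear_diff[OF linear_Phi, of S T] norm_Phi[of "S - T"] by simp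
    then show "S = T" by simp
  qed
  then show ?thesis
    unfolding cstar_isomorphism_onto_def bij_betw_def
    by (intro conjI allI range_Phi Phi_add Phi_scaleC Phi_mult Phi_adjoint norm_Phi)
qed

end

section \<open>Local finiteness of the field algebra\<close>

lemma prod_list_sets_commute:
  fixes Bs :: "'a::monoid_mult set list"
  assumes "\<And>B. B \<in> set Bs \<Longrightarrow> B * A \<subseteq> A * B"
  shows "prod_list Bs * A \<subseteq> A * prod_list Bs"
  using assms
proof (induction Bs)
  case (Cons B Bs)
  have "prod_list (B # Bs) * A = B * (prod_list Bs * A)" by (simp add: mult.assoc)
  also have "\<dots> \<subseteq> B * (A * prod_list Bs)" using Cons by (intro set_times_mono2[OF order_refl]) auto
  also have "\<dots> = (B * A) * prod_list Bs" by (simp add: mult.assoc)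
  also have "\<dots> \<subseteq> (A * B) * prod_list Bs" using Cons.prems by (intro set_times_mono2[OF _ order_refl]) auto
  finally show ?case by (simp add: mult.assoc)
qed (simp add: set_times_def)

text \<open>Normal ordering: in a product of two ordered words, the first block of the second word
  is moved left past the later blocks of the first and absorbed by its own kind.\<close>

lemma prod_list_sets_mult_closed:
  fixes Bs :: "'a::monoid_mult set list"
  assumes "\<And>B. B \<in> set Bs \<Longrightarrow> B * B \<subseteq> B" and "sorted_wrt (\<lambda>A B. B * A \<subseteq> A * B) Bs"
  shows "prod_list Bs * prod_list Bs \<subseteq> prod_list Bs"
  using assms
proof (induction Bs)
  case (Cons B Bs)
  have "prod_list (B # Bs) * prod_list (B # Bs) = B * (prod_list Bs * B) * prod_list Bs"
    by (simp add: mult.assoc)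
  also have "\<dots> \<subseteq> B * (B * prod_list Bs) * prod_list Bs"
    by (rule set_times_mono2[OF set_times_mono2[OF order_refl prod_list_sets_commute] order_refl])
      (use Cons.prems in auto)
  also have "\<dots> = (B * B) * (prod_list Bs * prod_list Bs)" by (simp add: mult.assoc)
  also have "\<dots> \<subseteq> B * prod_list Bs" using Cons by (intro set_times_mono2) auto
  finally show ?case by simp
qed (simp add: set_times_def)

lemma one_in_prod_list_sets:
  fixes Bs :: "'a::monoid_mult set list"
  shows "(\<And>B. B \<in> set Bs \<Longrightarrow> 1 \<in> B) \<Longrightarrow> 1 \<in> prod_list Bs"
proof (induction Bs)
  case (Cons B Bs)
  then show ?case using set_times_intro[of 1 B 1 "prod_list Bs"] by simp
qed simp

lemma subset_prod_list_sets:
  fixes Bs :: "'a::monoid_mult set list"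
  assumes "\<And>B. B \<in> set Bs \<Longrightarrow> 1 \<in> B" and "A \<in> set Bs"
  shows "A \<subseteq> prod_list Bs"
  using assms
proof (induction Bs)
  case (Cons B Bs)
  have "A \<subseteq> B * prod_list Bs"
  proof (cases "A = B")
    case True
    have "1 \<in> prod_list Bs" using Cons.prems by (intro one_in_prod_list_sets) auto
    then show ?thesis using True set_times_intro[of _ B 1 "prod_list Bs"] by auto
  next
    case False
    then have "A \<subseteq> prod_list Bs" using Cons by auto
    then show ?thesis using Cons.prems set_times_intro[of 1 B _ "prod_list Bs"] by auto
  qed
  then show ?case by simp
qed simp

lemma finite_prod_list_sets:
  fixes Bs :: "'a::monoid_mult set list"
  shows "(\<And>B. B \<in> set Bs \<Longrightarrow> finite B) \<Longrightarrow> finite (prod_list Bs)"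
  by (induction Bs) (auto intro: finite_set_times simp: set_one)

lemma span_mult_closed:
  fixes S :: "'a::real_algebra set"
  assumes S: "S * S \<subseteq> S" and x: "x \<in> span S" and y: "y \<in> span S"
  shows "x * y \<in> span S"
  using x
proof (induction rule: span_induct)
  case base
  then show ?case
    unfolding subspace_def
    by (auto simp: distrib_right span_zero intro: span_add span_scale)
next
  case (step a)
  show ?case using y
  proof (induction rule: span_induct)
    case base
    then show ?case
      unfolding subspace_def
      by (auto simp: distrib_left span_zero intro: span_add span_scale)
  next
    case (step b)
    with \<open>a \<in> S\<close> S show ?case by (blast intro: span_base)
  qed
qed

locale finite_field_algebra = field_algebra G \<delta> \<rho> + group G
  for G :: "('g, 'z) monoid_scheme" (structure)
    and \<delta> \<rho> :: "'g \<Rightarrow> int \<Rightarrow> 'f::cstar_algebra" +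
  assumes finite_carrier: "finite (carrier G)"
begin

abbreviation "Floc \<equiv> local_field_algebra G \<delta> \<rho>"

lemma term_eval_eqI:
  "field_rel G s t \<Longrightarrow> s \<in> field_terms G \<Longrightarrow> t \<in> field_terms G \<Longrightarrow>
    term_eval \<delta> \<rho> s = term_eval \<delta> \<rho> t"
  using presentation by simp

lemma rho_one: "\<rho> \<one> l = 1"
  using term_eval_eqI[OF field_rel.Rho_unit[of G l]] by (simp add: field_terms_def)

lemma delta_delta:
  "g \<in> carrier G \<Longrightarrow> h \<in> carrier G \<Longrightarrow> \<delta> g x * \<delta> h x = (if g = h then \<delta> g x else 0)"
  using term_eval_eqI[OF field_rel.Delta_orth[of g G h x]]
  by (auto simp: field_terms_def split: if_splits)

lemma rho_rho:
  "g \<in> carrier G \<Longrightarrow> h \<in> carrier G \<Longrightarrow> \<rho> g l * \<rho> h l = \<rho> (g \<otimes> h) l"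
  using term_eval_eqI[OF field_rel.Rho_mult[of g G h l]] by (simp add: field_terms_def)

lemma delta_commute:
  "g \<in> carrier G \<Longrightarrow> h \<in> carrier G \<Longrightarrow> \<delta> g x * \<delta> h y = \<delta> h y * \<delta> g x"
  using term_eval_eqI[OF field_rel.Delta_commute[of g G h x y]] by (simp add: field_terms_def)

lemma rho_delta:
  assumes "h \<in> carrier G" "g \<in> carrier G"
  shows "\<rho> h l * \<delta> g x = \<delta> (if half l < of_int x then h \<otimes> g else g) x * \<rho> h l"
proof (cases "half l < of_int x")
  case True
  then show ?thesis
    using term_eval_eqI[OF field_rel.Rho_Delta_less[of h G g l x]] assms
    by (simp add: field_terms_def)
next
  case False
  \<comment> \<open>The relations cover only strict inequalities; a parity argument excludes a
    half-integer equal to an integer.\<close>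
  have "half l \<noteq> of_int x"
  proof
    assume "half l = of_int x"
    then have "of_int (2 * l + 1) = (of_int (2 * x) :: rat)" by (simp add: half_def)
    then have "2 * l + 1 = 2 * x" by (simp only: of_int_eq_iff)
    then show False by presburger
  qed
  with False show ?thesis
    using term_eval_eqI[OF field_rel.Rho_Delta_greater[of h G g x l]] assms
    by (simp add: field_terms_def)
qed

lemma rho_rho_greater:
  "g \<in> carrier G \<Longrightarrow> h \<in> carrier G \<Longrightarrow> l' < l \<Longrightarrow>
    \<rho> g l * \<rho> h l' = \<rho> h l' * \<rho> (inv h \<otimes> g \<otimes> h) l"
  using term_eval_eqI[OF field_rel.Rho_Rho_greater[of g G h l' l]]
  by (simp add: field_terms_def half_def)

lemma star_delta: "g \<in> carrier G \<Longrightarrow> star (\<delta> g x) = \<delta> g x"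
  using term_eval_eqI[OF field_rel.Delta_Star[of g G x]] by (simp add: field_terms_def)

lemma star_rho: "h \<in> carrier G \<Longrightarrow> star (\<rho> h l) = \<rho> (inv h) l"
  using term_eval_eqI[OF field_rel.Rho_Star[of h G l]] by (simp add: field_terms_def)

lemma Floc_one: "1 \<in> Floc"
  unfolding local_field_algebra_def
  by (rule image_eqI[of _ _ One]) (simp_all add: field_terms_def)

lemma Floc_mult: "S \<in> Floc \<Longrightarrow> T \<in> Floc \<Longrightarrow> S * T \<in> Floc"
  unfolding local_field_algebra_def
  by (auto simp: field_terms_def intro!: image_eqI[of _ _ "Mul _ _"])

lemma Floc_star: "T \<in> Floc \<Longrightarrow> star T \<in> Floc"
  unfolding local_field_algebra_def
  by (auto simp: field_terms_def intro!: image_eqI[of _ _ "Star _"])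

text \<open>\<open>span\<close> is real linear; these four phases form a finite multiplicative set
  whose real span is all complex multiples of 1.\<close>

definition phase_block :: "'f set" where
  "phase_block = (\<lambda>c. c *\<^sub>C 1) ` {1, - 1, \<i>, - \<i>}"

text \<open>0 is adjoined for closure under products, by orthogonality, and 1 so that a block may be
  skipped in a word.\<close>

definition delta_block :: "int \<Rightarrow> 'f set" where
  "delta_block x = insert 0 (insert 1 ((\<lambda>g. \<delta> g x) ` carrier G))"

definition rho_block :: "int \<Rightarrow> 'f set" where
  "rho_block l = (\<lambda>h. \<rho> h l) ` carrier G"

text \<open>The normal order for words located in a bounded interval: phases, then all
  \<open>\<delta>\<close>, then all \<open>\<rho>\<close> by increasing position. Each defining
  exchange relation moves a later block past an earlier one.\<close>

definition blocks :: "int \<Rightarrow> 'f set list" where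
  "blocks N = phase_block # map delta_block [- N..N] @ map rho_block [- N..N]"

lemma in_blocksE:
  assumes "B \<in> set (blocks N)"
  obtains "B = phase_block" | x where "B = delta_block x" | l where "B = rho_block l"
  using assms by (auto simp: blocks_def)

lemma block_properties:
  assumes "B \<in> set (blocks N)"
  shows "finite B" "1 \<in> B" "B * B \<subseteq> B"
proof -
  have "finite B \<and> 1 \<in> B \<and> B * B \<subseteq> B"
    using assms
  proof (cases rule: in_blocksE)
    case 1
    then show ?thesis
      by (auto simp: phase_block_def set_times_def mult_scaleC_left scaleC_scaleC
          intro: image_eqI[of _ _ 1])
  next
    case (2 x)
    then show ?thesis
      by (auto simp: delta_block_def set_times_def finite_carrier delta_delta)
  next
    case (3 l)
    then show ?thesis
      using rho_one[of l, symmetric]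
      by (auto simp: rho_block_def set_times_def finite_carrier rho_rho)
  qed
  then show "finite B" "1 \<in> B" "B * B \<subseteq> B" by auto
qed

lemma sorted_blocks: "sorted_wrt (\<lambda>A B. B * A \<subseteq> A * B) (blocks N)"
proof -
  have phase: "B * phase_block \<subseteq> phase_block * B" for B
    by (auto simp: phase_block_def set_times_def mult_scaleC_left mult_scaleC_right)
  have delta: "delta_block y * delta_block x \<subseteq> delta_block x * delta_block y" for x y
  proof -
    have "b * a = a * b" if "a \<in> delta_block x" "b \<in> delta_block y" for a b
      using that by (auto simp: delta_block_def delta_commute)
    then show ?thesis by (auto simp: set_times_def)
  qed
  have rho_delta: "rho_block l * delta_block x \<subseteq> delta_block x * rho_block l" for l x
  proof
    fix z assume "z \<in> rho_block l * delta_block x"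
    then obtain h b where h: "h \<in> carrier G" and b: "b \<in> delta_block x" and z: "z = \<rho> h l * b"
      by (auto simp: set_times_def rho_block_def)
    from b consider "b = 0" | "b = 1" | g where "g \<in> carrier G" "b = \<delta> g x"
      by (auto simp: delta_block_def)
    then obtain b' where "b' \<in> delta_block x" "\<rho> h l * b = b' * \<rho> h l"
    proof cases
      case 1
      then show ?thesis using that[of 0] by (simp add: delta_block_def)
    next
      case 2
      then show ?thesis using that[of 1] by (simp add: delta_block_def)
    next
      case 3
      then show ?thesis
        using that[of "\<delta> (if half l < of_int x then h \<otimes> g else g) x"] h
        by (simp add: delta_block_def rho_delta)
    qed
    then show "z \<in> delta_block x * rho_block l"
      using h z set_times_intro[of b' "delta_block x" "\<rho> h l" "rho_block l"]
      by (simp add: rho_block_def)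
  qed
  have rho: "rho_block l * rho_block l' \<subseteq> rho_block l' * rho_block l" if "l' < l" for l l'
  proof
    fix z assume "z \<in> rho_block l * rho_block l'"
    then obtain g h where "g \<in> carrier G" "h \<in> carrier G" "z = \<rho> g l * \<rho> h l'"
      by (auto simp: set_times_def rho_block_def)
    then show "z \<in> rho_block l' * rho_block l"
      using set_times_intro[of "\<rho> h l'" "rho_block l'" "\<rho> (inv h \<otimes> g \<otimes> h) l" "rho_block l"]
      by (simp add: rho_block_def rho_rho_greater that)
  qed
  have "sorted_wrt (\<lambda>l' l. rho_block l * rho_block l' \<subseteq> rho_block l' * rho_block l) [- N..N]"
    by (rule sorted_wrt_mono_rel[of _ "(<)"]) (simp_all add: rho)
  moreover have "sorted_wrt (\<lambda>x y. delta_block y * delta_block x \<subseteq> delta_block x * delta_block y)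
      [- N..N]"
    by (rule sorted_wrt_mono_rel[of _ "(<)"]) (simp_all add: delta)
  ultimately show ?thesis
    by (auto simp: blocks_def sorted_wrt_append sorted_wrt_map phase rho_delta)
qed

text \<open>A finite-dimensional algebra: the product of the finite blocks is finite and closed
  under multiplication.\<close>

definition local_span :: "int \<Rightarrow> 'f set" where
  "local_span N = span (prod_list (blocks N))"

lemma block_subset_local_span: "B \<in> set (blocks N) \<Longrightarrow> B \<subseteq> local_span N"
  unfolding local_span_def
  using subset_prod_list_sets[of "blocks N" B] block_properties(2) span_superset by blast

lemma local_span_mult: "S \<in> local_span N \<Longrightarrow> T \<in> local_span N \<Longrightarrow> S * T \<in> local_span N"
  unfolding local_span_def
  by (intro span_mult_closed prod_list_sets_mult_closed sorted_blocks block_properties(3))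

lemma local_span_add: "S \<in> local_span N \<Longrightarrow> T \<in> local_span N \<Longrightarrow> S + T \<in> local_span N"
  unfolding local_span_def by (rule span_add)

lemma scaleC_one_local_span: "c *\<^sub>C 1 \<in> local_span N"
proof -
  have "phase_block \<subseteq> local_span N" by (rule block_subset_local_span) (simp add: blocks_def)
  then have "Re c *\<^sub>R (1 *\<^sub>C 1) + Im c *\<^sub>R (\<i> *\<^sub>C 1) \<in> local_span N"
    unfolding local_span_def by (intro span_add span_scale) (auto simp: phase_block_def)
  also have "Re c *\<^sub>R (1 *\<^sub>C 1 :: 'f) + Im c *\<^sub>R (\<i> *\<^sub>C 1) =
      (complex_of_real (Re c) + \<i> * complex_of_real (Im c)) *\<^sub>C 1"
    by (simp add: scaleR_conv_scaleC scaleC_scaleC scaleC_add_left mult.commute)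
  also have "complex_of_real (Re c) + \<i> * complex_of_real (Im c) = c"
    by (rule complex_eq [symmetric])
  finally show ?thesis .
qed

lemma local_span_scaleC: "T \<in> local_span N \<Longrightarrow> c *\<^sub>C T \<in> local_span N"
  using local_span_mult[OF scaleC_one_local_span[of c]] by (fastforce simp: mult_scaleC_left)

lemma delta_local_span:
  assumes "g \<in> carrier G" "\<bar>x\<bar> \<le> N"
  shows "\<delta> g x \<in> local_span N"
proof -
  have "x \<in> set [- N..N]" using assms by auto
  then have "delta_block x \<in> set (blocks N)" by (simp add: blocks_def)
  from subsetD[OF block_subset_local_span[OF this]] show ?thesis
    using assms by (simp add: delta_block_def)
qed

lemma rho_local_span:
  assumes "h \<in> carrier G" "\<bar>l\<bar> \<le> N"
  shows "\<rho> h l \<in> local_span N"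
proof -
  have "l \<in> set [- N..N]" using assms by auto
  then have "rho_block l \<in> set (blocks N)" by (simp add: blocks_def)
  from subsetD[OF block_subset_local_span[OF this]] show ?thesis
    using assms by (simp add: rho_block_def)
qed

text \<open>The adjoint is carried along for the \<open>Star\<close> case, and "all \<open>N\<close>
  from some \<open>M\<close> on" lets the bounds of two subterms be merged by
  \<open>max\<close>.\<close>

lemma term_eval_local_span:
  assumes "t \<in> field_terms G"
  shows "\<exists>M. \<forall>N\<ge>M. term_eval \<delta> \<rho> t \<in> local_span N \<and> star (term_eval \<delta> \<rho> t) \<in> local_span N"
    (is "\<exists>M. ?P t M")
  using assms
proof (induction t)
  case (Delta g x)
  then have "?P (Delta g x) \<bar>x\<bar>" by (auto simp: field_terms_def star_delta delta_local_span)
  then show ?case by blast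
next
  case (Rho h l)
  then have "?P (Rho h l) \<bar>l\<bar>" by (auto simp: field_terms_def star_rho rho_local_span)
  then show ?case by blast
next
  case One
  then show ?case using scaleC_one_local_span[of 1] by simp
next
  case (Scale c t)
  then obtain M where "?P t M" by (auto simp: field_terms_def)
  then have "?P (Scale c t) M" by (simp add: star_scaleC local_span_scaleC)
  then show ?case by blast
next
  case (Add s t)
  then obtain M M' where "?P s M" "?P t M'" by (auto simp: field_terms_def)
  then have "?P (Add s t) (max M M')" by (simp add: star_add local_span_add)
  then show ?case by blast
next
  case (Mul s t)
  then obtain M M' where "?P s M" "?P t M'" by (auto simp: field_terms_def)
  then have "?P (Mul s t) (max M M')" by (simp add: star_mult local_span_mult)
  then show ?case by blast
next
  case (Star t)
  then obtain M where "?P t M" by (auto simp: field_terms_def)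
  then have "?P (Star t) M" by (simp add: star_star)
  then show ?case by blast
qed

lemma Floc_powers_in_finite_span:
  assumes "T \<in> Floc"
  shows "\<exists>S. finite S \<and> (\<forall>n. T ^ n \<in> span S)"
proof -
  obtain N where N: "T \<in> local_span N"
    using assms term_eval_local_span by (fastforce simp: local_field_algebra_def)
  have "T ^ n \<in> local_span N" for n
    using scaleC_one_local_span[of 1 N] by (induction n) (simp_all add: local_span_mult N)
  then show ?thesis
    unfolding local_span_def using finite_prod_list_sets block_properties(1) by blast
qed

end

section \<open>The crossed products\<close>

lemma sum_bvec:
  fixes f :: "'i \<Rightarrow> 'a::cstar_algebra"
  assumes "finite S" "i \<in> S"
  shows "(\<Sum>k\<in>S. bvec i k *\<^sub>C f k) = f i"
proof -
  have "(\<Sum>k\<in>S. bvec i k *\<^sub>C f k) = (\<Sum>k\<in>S. if k = i then f k else 0)"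
    by (rule sum.cong) (simp_all add: bvec_def)
  then show ?thesis using assms by simp
qed

lemma sum_sum_bvec:
  fixes f :: "'i \<Rightarrow> 'a::cstar_algebra"
  assumes "finite S" "\<And>t. t \<in> T \<Longrightarrow> e t \<in> S"
  shows "(\<Sum>k\<in>S. (\<Sum>t\<in>T. bvec (e t) k) *\<^sub>C f k) = (\<Sum>t\<in>T. f (e t))"
proof -
  have "(\<Sum>k\<in>S. (\<Sum>t\<in>T. bvec (e t) k) *\<^sub>C f k) = (\<Sum>t\<in>T. \<Sum>k\<in>S. bvec (e t) k *\<^sub>C f k)"
    by (simp add: scaleC_sum_left sum.swap[of _ T S])
  then show ?thesis using assms by (simp add: sum_bvec)
qed

locale spin_crossed_products =
  finite_field_algebra G \<delta> \<rho> +
  act: double_action G \<delta> \<rho> act +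
  cp: crossed_product "quantum_double G" act "local_field_algebra G \<delta> \<rho>" tens +
  dual: dual_action G tens dact +
  cp2: crossed_product "dual_double G" dact UNIV tens2
  for G :: "('g, 'z) monoid_scheme" (structure)
    and \<delta> \<rho> :: "'g \<Rightarrow> int \<Rightarrow> 'f::cstar_algebra"
    and act :: "'g \<times> 'g \<Rightarrow> 'f \<Rightarrow> 'f"
    and tens :: "'f \<Rightarrow> 'g \<times> 'g \<Rightarrow> 'c::cstar_algebra"
    and dact :: "'g \<times> 'g \<Rightarrow> 'c \<Rightarrow> 'c"
    and tens2 :: "'c \<Rightarrow> 'g \<times> 'g \<Rightarrow> 'd::cstar_algebra"
begin

abbreviation "C \<equiv> carrier G"

lemma finite_basis: "finite (C \<times> C)"
  using finite_carrier by simp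

lemma hbasis_eq [simp]: "hbasis (quantum_double G) = C \<times> C" "hbasis (dual_double G) = C \<times> C"
  by (simp_all add: quantum_double_def dual_double_def)

lemma mult_inv_cancel: "s \<in> C \<Longrightarrow> g \<in> C \<Longrightarrow> s \<otimes> (inv s \<otimes> g) = g"
  by (metis inv_closed l_one m_assoc r_inv)

lemma sum_translate_inverse:
  assumes "s \<in> C"
  shows "(\<Sum>g\<in>C. f (s \<otimes> inv g)) = (\<Sum>g\<in>C. f g)"
  by (rule sum.reindex_bij_witness[of _ "\<lambda>g. inv g \<otimes> s" "\<lambda>g. s \<otimes> inv g"])
    (use assms in \<open>simp_all add: m_assoc inv_mult_group mult_inv_cancel\<close>)

lemma sum_inverse: "(\<Sum>g\<in>C. f (inv g)) = (\<Sum>g\<in>C. f g)"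
  using sum_translate_inverse[of \<one> f] by simp

lemma sum_left_translate:
  assumes "s \<in> C"
  shows "(\<Sum>g\<in>C. f (s \<otimes> g)) = (\<Sum>g\<in>C. f g)"
  using sum_translate_inverse[OF assms, of f] sum_inverse[of "\<lambda>g. f (s \<otimes> g)"] by simp

lemma sum_right_translate_inverse:
  assumes "s \<in> C"
  shows "(\<Sum>g\<in>C. f (g \<otimes> inv s)) = (\<Sum>g\<in>C. f g)"
  by (rule sum.reindex_bij_witness[of _ "\<lambda>g. g \<otimes> s" "\<lambda>g. g \<otimes> inv s"])
    (use assms in \<open>simp_all add: m_assoc\<close>)

lemmas act_bounded = act.bounded[unfolded hbasis_eq]
lemmas dact_bounded = dual.bounded[unfolded hbasis_eq]
lemmas tens_bounded = cp.bounded[unfolded hbasis_eq]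
lemmas tens2_bounded = cp2.bounded[unfolded hbasis_eq]

lemma tens_linear: "i \<in> C \<times> C \<Longrightarrow> linear (\<lambda>T. tens T i)"
  using tens_bounded bounded_clinear_linear bounded_linear.linear by blast

lemma tens2_linear: "i \<in> C \<times> C \<Longrightarrow> linear (\<lambda>X. tens2 X i)"
  using tens2_bounded bounded_clinear_linear bounded_linear.linear by blast

lemma sum_hcomult_quantum_double:
  assumes "g \<in> C" "h \<in> C"
  shows "(\<Sum>(p, q)\<in>(C \<times> C) \<times> (C \<times> C). hcomult (quantum_double G) (g, h) (p, q) *\<^sub>C f p q) =
    (\<Sum>t\<in>C. f (t, h) (inv t \<otimes> g, h) :: 'x::cstar_algebra)"
  using sum_sum_bvec[of "(C \<times> C) \<times> (C \<times> C)" C "\<lambda>t. ((t, h), (inv t \<otimes> g, h))" "\<lambda>(p, q). f p q"]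
    assms finite_basis
  by (simp add: quantum_double_def case_prod_unfold)

lemma sum_hcomult_dual_double:
  assumes "y \<in> C" "x \<in> C"
  shows "(\<Sum>(p, q)\<in>(C \<times> C) \<times> (C \<times> C). hcomult (dual_double G) (y, x) (p, q) *\<^sub>C f p q) =
    (\<Sum>t\<in>C. f (y, inv t) (t \<otimes> y \<otimes> inv t, t \<otimes> x) :: 'x::cstar_algebra)"
  using sum_sum_bvec[of "(C \<times> C) \<times> (C \<times> C)" C
      "\<lambda>t. ((y, inv t), (t \<otimes> y \<otimes> inv t, t \<otimes> x))" "\<lambda>(p, q). f p q"]
    assms finite_basis
  by (simp add: dual_double_def case_prod_unfold)

lemma sum_hmult_quantum_double:
  assumes "g1 \<in> C" "h1 \<in> C" "g2 \<in> C" "h2 \<in> C"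
  shows "(\<Sum>r\<in>C \<times> C. hmult (quantum_double G) (g1, h1) (g2, h2) r *\<^sub>C f r) =
    (if g1 \<otimes> h1 = h1 \<otimes> g2 then f (g1, h1 \<otimes> h2) else 0 :: 'x::cstar_algebra)"
  using assms by (simp add: quantum_double_def sum_bvec finite_basis)

lemma sum_hmult_dual_double:
  assumes "y \<in> C" "x \<in> C" "w \<in> C" "z \<in> C"
  shows "(\<Sum>r\<in>C \<times> C. hmult (dual_double G) (y, x) (w, z) r *\<^sub>C f r) =
    (if x = z then f (y \<otimes> w, x) else 0 :: 'x::cstar_algebra)"
  using assms by (simp add: dual_double_def sum_bvec finite_basis)

lemma cp_incl_eq: "cp_incl (quantum_double G) tens T = (\<Sum>g\<in>C. tens T (g, \<one>))"
  using sum_sum_bvec[of "C \<times> C" C "\<lambda>g. (g, \<one>)" "tens T"] finite_basis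
  by (simp add: cp_incl_def quantum_double_def)

lemma cp_incl2_eq: "cp_incl (dual_double G) tens2 X = (\<Sum>z\<in>C. tens2 X (\<one>, z))"
  using sum_sum_bvec[of "C \<times> C" C "\<lambda>z. (\<one>, z)" "tens2 X"] finite_basis
  by (simp add: cp_incl_def dual_double_def)

abbreviation "\<iota> \<equiv> cp_incl (quantum_double G) tens"
abbreviation "J \<equiv> cp_incl (dual_double G) tens2"

lemma iota_bounded: "bounded_clinear \<iota>"
  unfolding cp_incl_eq[abs_def] by (intro bounded_clinear_sum tens_bounded) simp

text \<open>\<open>1 = \<rho> \<one> 0\<close> is a generator, so the action on it is prescribed,
  and equals the counit.\<close>

lemma act_one:
  assumes "g \<in> C" "h \<in> C"
  shows "act (g, h) 1 = (if g = \<one> then 1 else 0)"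
  using act.act_rho[of g h \<one> 0] assms by (simp add: rho_one)

lemma act_mult:
  assumes "g \<in> C" "h \<in> C"
  shows "act (g, h) (S * T) = (\<Sum>s\<in>C. act (s, h) S * act (inv s \<otimes> g, h) T)"
  using act.act_mult[of "(g, h)" S T] assms
  by (simp add: sum_hcomult_quantum_double)

text \<open>The unit of the double acts by \<open>U\<close>, which is multiplicative because the
  second leg of the coproduct is a translate of \<open>g\<close>; it therefore suffices to look at
  generators.\<close>

lemma act_unit:
  assumes "T \<in> Floc"
  shows "(\<Sum>g\<in>C. act (g, \<one>) T) = T"
proof -
  define U where "U = (\<lambda>T. \<Sum>g\<in>C. act (g, \<one>) T)"
  have U: "bounded_clinear U"
    unfolding U_def by (intro bounded_clinear_sum act_bounded) simp
  interpret U: bounded_linear U by (rule bounded_clinear_linear[OF U])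
  have U_mult: "U (S * T) = U S * U T" for S T
  proof -
    have "U (S * T) = (\<Sum>g\<in>C. \<Sum>s\<in>C. act (s, \<one>) S * act (inv s \<otimes> g, \<one>) T)"
      by (simp add: U_def act_mult)
    also have "\<dots> = (\<Sum>s\<in>C. \<Sum>g\<in>C. act (s, \<one>) S * act (inv s \<otimes> g, \<one>) T)"
      by (rule sum.swap)
    also have "\<dots> = U S * U T"
      by (simp add: U_def sum_left_translate[of _ "\<lambda>g. act (g, \<one>) T"]
          sum_distrib_left [symmetric] sum_distrib_right [symmetric])
    finally show ?thesis .
  qed
  have U_one: "U 1 = 1" by (simp add: U_def act_one finite_carrier)
  have U_delta: "U (\<delta> f x) = \<delta> f x" if "f \<in> C" for f x
    using that by (simp add: U_def act.act_delta finite_carrier)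
  have U_rho: "U (\<rho> t l) = \<rho> t l" if "t \<in> C" for t l
    using that by (simp add: U_def act.act_rho finite_carrier)
  \<comment> \<open>Compatibility of \<open>U\<close> with \<open>star\<close> is not among the
    known facts, so the induction treats each term together with its adjoint.\<close>
  have "U (term_eval \<delta> \<rho> t) = term_eval \<delta> \<rho> t \<and>
      U (star (term_eval \<delta> \<rho> t)) = star (term_eval \<delta> \<rho> t)" if "t \<in> field_terms G" for t
    using that
    by (induction t)
      (simp_all add: field_terms_def U_delta U_rho U_one U_mult U.add star_delta star_rho
        bounded_clinear_scaleC[OF U] star_scaleC star_add star_mult star_star)
  then show ?thesis using assms by (auto simp: local_field_algebra_def U_def)
qed

lemma tens_mult:
  assumes "T \<in> Floc" "S \<in> Floc" and C: "g \<in> C" "h \<in> C" "k \<in> C" "l \<in> C"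
  shows "tens T (g, h) * tens S (k, l) =
    tens (T * act (g \<otimes> inv (h \<otimes> k \<otimes> inv h), h) S) (h \<otimes> k \<otimes> inv h, h \<otimes> l)"
proof -
  let ?t = "g \<otimes> inv (h \<otimes> k \<otimes> inv h)"
  \<comment> \<open>The product in the double vanishes unless its index condition holds, which
    singles out one summand \<open>t\<close> of the coproduct.\<close>
  have t: "inv t \<otimes> g \<otimes> h = h \<otimes> k \<longleftrightarrow> t = ?t" if "t \<in> C" for t
  proof -
    have "inv t \<otimes> g \<otimes> h = h \<otimes> k \<longleftrightarrow> inv t \<otimes> g = h \<otimes> k \<otimes> inv h"
      using that C by (metis inv_closed inv_solve_right m_closed)
    also have "\<dots> \<longleftrightarrow> g = t \<otimes> (h \<otimes> k \<otimes> inv h)"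
      using that C by (metis inv_closed inv_solve_left m_closed)
    also have "\<dots> \<longleftrightarrow> t = ?t"
      using that C by (metis inv_closed inv_solve_right m_closed)
    finally show ?thesis .
  qed
  have "tens T (g, h) * tens S (k, l) = (\<Sum>t\<in>C. if t = ?t
      then tens (T * act (t, h) S) (inv t \<otimes> g, h \<otimes> l) else 0)"
    using assms
    by (simp add: cp.mult sum_hcomult_quantum_double sum_hmult_quantum_double t cong: if_cong)
  also have "\<dots> = tens (T * act (?t, h) S) (inv ?t \<otimes> g, h \<otimes> l)"
    using C by (simp add: finite_carrier)
  also have "inv ?t \<otimes> g = h \<otimes> k \<otimes> inv h" using C by (simp add: inv_mult_group m_assoc)
  finally show ?thesis .
qed

lemma tens_mult_one:
  assumes "T \<in> Floc" and C: "g \<in> C" "h \<in> C" "k \<in> C" "l \<in> C"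
  shows "tens T (g, h) * tens 1 (k, l) =
    (if g = h \<otimes> k \<otimes> inv h then tens T (g, h \<otimes> l) else 0)"
proof -
  have "g \<otimes> inv (h \<otimes> k \<otimes> inv h) = \<one> \<longleftrightarrow> g = h \<otimes> k \<otimes> inv h"
    using C by (metis inv_solve_right' l_one m_closed inv_closed one_closed)
  moreover have "tens 0 (h \<otimes> k \<otimes> inv h, h \<otimes> l) = 0"
    using C by (intro linear_0[OF tens_linear]) simp
  ultimately show ?thesis
    using assms by (simp add: tens_mult Floc_one act_one)
qed

lemma iota_mult:
  assumes "S \<in> Floc" "T \<in> Floc"
  shows "\<iota> S * \<iota> T = \<iota> (S * T)"
proof -
  have "\<iota> S * \<iota> T = (\<Sum>k\<in>C. \<Sum>g\<in>C. tens (S * act (g \<otimes> inv k, \<one>) T) (k, \<one>))"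
    unfolding cp_incl_eq sum_product
    by (subst sum.swap) (simp add: tens_mult assms)
  also have "\<dots> = (\<Sum>k\<in>C. tens (S * (\<Sum>g\<in>C. act (g \<otimes> inv k, \<one>) T)) (k, \<one>))"
    by (intro sum.cong) (simp_all add: sum_distrib_left linear_sum[OF tens_linear])
  also have "\<dots> = (\<Sum>k\<in>C. tens (S * T) (k, \<one>))"
    by (intro sum.cong)
      (simp_all add: sum_right_translate_inverse[of _ "\<lambda>g. act (g, \<one>) T"] act_unit assms)
  finally show ?thesis by (simp add: cp_incl_eq)
qed

lemma star_tens:
  assumes "T \<in> Floc" "g \<in> C" "h \<in> C"
  shows "star (tens T (g, h)) = tens 1 (inv h \<otimes> g \<otimes> h, inv h) * \<iota> (star T)"
  using assms cp.star[of T "(g, h)"]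
  by (simp add: quantum_double_def sum_bvec finite_basis)

lemma star_tens_one:
  "g \<in> C \<Longrightarrow> h \<in> C \<Longrightarrow> star (tens 1 (g, h)) = tens 1 (inv h \<otimes> g \<otimes> h, inv h)"
  by (simp add: star_tens Floc_one cp.unit)

lemma star_iota:
  assumes "T \<in> Floc"
  shows "star (\<iota> T) = \<iota> (star T)"
proof -
  have "star (\<iota> T) = \<iota> 1 * \<iota> (star T)"
    unfolding cp_incl_eq[of T] star_sum using assms
    by (simp add: star_tens cp_incl_eq[of 1] sum_distrib_right)
  then show ?thesis by (simp add: cp.unit)
qed

lemma tens_dense:
  assumes "closed {x. P x}" and P_add: "\<And>x y. P x \<Longrightarrow> P y \<Longrightarrow> P (x + y)" and "P 0"
    and P_tens: "\<And>T g h. T \<in> Floc \<Longrightarrow> g \<in> C \<Longrightarrow> h \<in> C \<Longrightarrow> P (tens T (g, h))"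
  shows "P x"
proof -
  have P_sum: "P (\<Sum>i\<in>I. f i)" if "\<And>i. i \<in> I \<Longrightarrow> P (f i)" for I and f :: "'g \<times> 'g \<Rightarrow> 'c"
    using that by (induction I rule: infinite_finite_induct) (auto intro: P_add \<open>P 0\<close>)
  have "{\<Sum>i\<in>C \<times> C. tens (X i) i | X. \<forall>i\<in>C \<times> C. X i \<in> Floc} \<subseteq> {x. P x}"
    by (auto intro!: P_sum P_tens)
  from closure_minimal[OF this assms(1)] show ?thesis using cp.dense by auto
qed

section \<open>The conditional expectation and the dual action\<close>

definition n :: complex where "n = of_nat (card C)"

lemma n_nonzero [simp]: "n \<noteq> 0"
  using finite_carrier one_closed by (auto simp: n_def)

abbreviation "E \<equiv> cond_exp2 G dact"

lemma cond_exp2_eq: "E x = (1 / n) *\<^sub>C (\<Sum>y\<in>C. dact (y, \<one>) x)"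
  using sum_sum_bvec[of "C \<times> C" C "\<lambda>y. (y, \<one>)" "\<lambda>i. dact i x"] finite_basis
  by (simp only: cond_exp2_def lin_act_def dual_integral_def n_def scaleC_scaleC [symmetric]
      scaleC_sum_right [symmetric] hbasis_eq) simp

lemma cond_exp2_bounded: "bounded_clinear E"
  unfolding cond_exp2_eq[abs_def]
  by (intro bounded_clinear_compose[OF bounded_clinear_scaleC_right] bounded_clinear_sum
      dact_bounded) simp

lemma cond_exp2_tens:
  assumes "g \<in> C" "h \<in> C"
  shows "E (tens T (g, h)) = (if h = \<one> then (1 / n) *\<^sub>C \<iota> T else 0)"
  using assms sum_translate_inverse[of g "\<lambda>k. tens T (k, \<one>)"]
  by (simp add: cond_exp2_eq dual.dact_tens cp_incl_eq)

lemma cond_exp2_iota: "E (\<iota> T) = \<iota> T"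
proof -
  interpret E: bounded_linear E by (rule bounded_clinear_linear[OF cond_exp2_bounded])
  have "E (\<iota> T) = (\<Sum>g\<in>C. (1 / n) *\<^sub>C \<iota> T)"
    unfolding cp_incl_eq[of T] E.sum by (simp add: cond_exp2_tens cp_incl_eq)
  also have "\<dots> = (\<Sum>g\<in>C. 1 / n) *\<^sub>C \<iota> T" by (simp only: scaleC_sum_left)
  also have "(\<Sum>g\<in>C. 1 / n) = 1" using n_nonzero by (simp add: n_def)
  finally show ?thesis by simp
qed

text \<open>On an elementary tensor over \<open>(g, h)\<close> only \<open>z = h\<close>
  contributes, and it acts trivially; density does the rest.\<close>

lemma dact_unit: "(\<Sum>z\<in>C. dact (\<one>, z) x) = x"
proof (rule tens_dense[of "\<lambda>x. (\<Sum>z\<in>C. dact (\<one>, z) x) = x"])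
  let ?U = "\<lambda>x. \<Sum>z\<in>C. dact (\<one>, z) x"
  have "bounded_linear ?U"
    by (intro bounded_linear_sum bounded_clinear_linear dact_bounded) simp
  then interpret U: bounded_linear ?U .
  show "closed {x. ?U x = x}"
    by (intro closed_Collect_eq U.continuous_on continuous_on_id)
  show "?U (x + y) = x + y" if "?U x = x" "?U y = y" for x y
    using that by (simp only: U.add)
  show "?U 0 = 0" by (rule U.zero)
  show "?U (tens T (g, h)) = tens T (g, h)" if "g \<in> C" "h \<in> C" for T g h
    using that by (simp add: dual.dact_tens finite_carrier cong: if_cong)
qed

lemma tens2_mult:
  assumes C: "y \<in> C" "x \<in> C" "w \<in> C" "z \<in> C"
  shows "tens2 X (y, x) * tens2 Y (w, z) =
    tens2 (X * dact (y, x \<otimes> inv z) Y) (z \<otimes> inv x \<otimes> y \<otimes> inv (z \<otimes> inv x) \<otimes> w, z)"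
proof -
  let ?t = "z \<otimes> inv x"
  have t: "t \<otimes> x = z \<longleftrightarrow> t = ?t" if "t \<in> C" for t
    using that C by (metis inv_solve_right)
  have "tens2 X (y, x) * tens2 Y (w, z) = (\<Sum>t\<in>C. if t = ?t
      then tens2 (X * dact (y, inv t) Y) (t \<otimes> y \<otimes> inv t \<otimes> w, t \<otimes> x) else 0)"
    using C
    by (simp add: cp2.mult sum_hcomult_dual_double sum_hmult_dual_double t cong: if_cong)
  also have "\<dots> = tens2 (X * dact (y, inv ?t) Y) (?t \<otimes> y \<otimes> inv ?t \<otimes> w, ?t \<otimes> x)"
    using C by (simp add: finite_carrier)
  also have "inv ?t = x \<otimes> inv z" using C by (simp add: inv_mult_group)
  also have "?t \<otimes> x = z" using C by (simp add: m_assoc)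
  finally show ?thesis using C by (simp add: inv_mult_group)
qed

text \<open>\<open>k X\<close> is $X \otimes E_2$.\<close>

definition k :: "'c \<Rightarrow> 'd" where
  "k X = (1 / n) *\<^sub>C (\<Sum>w\<in>C. tens2 X (w, \<one>))"

lemma k_bounded: "bounded_clinear k"
  unfolding k_def[abs_def]
  by (intro bounded_clinear_compose[OF bounded_clinear_scaleC_right] bounded_clinear_sum
      tens2_bounded) simp

lemma linear_k: "linear k"
  using bounded_clinear_linear[OF k_bounded] by (rule bounded_linear.linear)

text \<open>Left invariance of the integral: left multiplication by a group element permutes the
  summands of \<open>k\<close>, so \<open>(y, x)\<close> acts only on \<open>Y\<close>.\<close>

lemma tens2_k:
  assumes C: "y \<in> C" "x \<in> C"
  shows "tens2 X (y, x) * k Y = k (X * dact (y, x) Y)"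
proof -
  have "tens2 X (y, x) * k Y = (1 / n) *\<^sub>C
      (\<Sum>w\<in>C. tens2 (X * dact (y, x) Y) (inv x \<otimes> y \<otimes> x \<otimes> w, \<one>))"
    using C by (simp add: k_def mult_scaleC_right sum_distrib_left tens2_mult)
  also have "\<dots> = k (X * dact (y, x) Y)"
    using C sum_left_translate[of "inv x \<otimes> y \<otimes> x" "\<lambda>w. tens2 (X * dact (y, x) Y) (w, \<one>)"]
    by (simp add: k_def)
  finally show ?thesis .
qed

lemma J_k: "J X * k Y = k (X * Y)"
proof -
  have "J X * k Y = k (X * (\<Sum>z\<in>C. dact (\<one>, z) Y))"
    by (simp add: cp_incl2_eq sum_distrib_right tens2_k linear_sum[OF linear_k] sum_distrib_left)
  then show ?thesis by (simp add: dact_unit)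
qed

lemma k_k: "k X * k Y = k (X * E Y)"
proof -
  have "k X * k Y = (1 / n) *\<^sub>C (\<Sum>w\<in>C. k (X * dact (w, \<one>) Y))"
    by (simp add: k_def[of X] mult_scaleC_left sum_distrib_right tens2_k)
  also have "\<dots> = k ((1 / n) *\<^sub>C (\<Sum>w\<in>C. X * dact (w, \<one>) Y))"
    by (simp add: bounded_clinear_scaleC[OF k_bounded] linear_sum[OF linear_k])
  finally show ?thesis by (simp add: cond_exp2_eq mult_scaleC_right sum_distrib_left)
qed

text \<open>The integral is self-adjoint because inversion permutes the group.\<close>

lemma star_k: "star (k X) = k 1 * J (star X)"
proof -
  have tens2: "star (tens2 X (w, \<one>)) = tens2 1 (inv w, \<one>) * J (star X)" if "w \<in> C" for w
    using that cp2.star[of X "(w, \<one>)"] by (simp add: dual_double_def sum_bvec finite_basis)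
  have "star (k X) = (1 / n) *\<^sub>C (\<Sum>w\<in>C. tens2 1 (inv w, \<one>) * J (star X))"
    by (simp add: k_def star_scaleC star_sum tens2 n_def)
  also have "\<dots> = k 1 * J (star X)"
    using sum_inverse[of "\<lambda>w. tens2 1 (w, \<one>)"]
    by (simp add: k_def mult_scaleC_left sum_distrib_right [symmetric])
  finally show ?thesis .
qed

lemma star_k_k: "star (k X) * k Y = k (E (star X * Y))"
  by (simp add: star_k mult.assoc J_k k_k)

text \<open>A multiple of \<open>k X\<close> is a sum of elementary tensors with coefficient
  \<open>X\<close> at \<open>(\<one>, \<one>)\<close>, and coefficients are unique.\<close>

lemma k_injective:
  assumes "k X = 0"
  shows "X = 0"
proof -
  let ?X = "\<lambda>i. if snd i = \<one> then X else 0"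
  have zero: "tens2 0 i = 0" if "i \<in> C \<times> C" for i using that by (rule linear_0[OF tens2_linear])
  have "(\<Sum>i\<in>C \<times> C. tens2 (?X i) i) = (\<Sum>w\<in>C. \<Sum>z\<in>C. if z = \<one> then tens2 X (w, \<one>) else 0)"
    unfolding sum.cartesian_product by (intro sum.cong) (auto simp: zero)
  also have "\<dots> = (\<Sum>w\<in>C. tens2 X (w, \<one>))" by (simp add: finite_carrier)
  also have "\<dots> = n *\<^sub>C k X" by (simp add: k_def scaleC_scaleC)
  finally have "(\<Sum>i\<in>C \<times> C. tens2 (?X i) i) = 0" using assms by simp
  then have "?X (\<one>, \<one>) = 0" by (intro cp2.inj[of ?X "(\<one>, \<one>)"]) simp_all
  then show ?thesis by simp
qed

lemma k_left_ideal: "closure {T. \<forall>X. T * k X \<in> range k} = UNIV"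
proof -
  have "{\<Sum>i\<in>C \<times> C. tens2 (Y i) i | Y. \<forall>i\<in>C \<times> C. Y i \<in> UNIV} \<subseteq> {T. \<forall>X. T * k X \<in> range k}"
  proof clarify
    fix Y X
    have "(\<Sum>i\<in>C \<times> C. tens2 (Y i) i) * k X = k (\<Sum>i\<in>C \<times> C. Y i * dact i X)"
      unfolding sum_distrib_right linear_sum[OF linear_k]
      by (intro sum.cong) (auto simp: tens2_k)
    then show "(\<Sum>i\<in>C \<times> C. tens2 (Y i) i) * k X \<in> range k" by (rule range_eqI)
  qed
  from closure_mono[OF this] show ?thesis using cp2.dense by auto
qed

lemma tens2_J:
  assumes "w \<in> C"
  shows "tens2 X (w, \<one>) * J Y =
    (\<Sum>z\<in>C. tens2 (X * dact (w, inv z) Y) (z \<otimes> w \<otimes> inv z, z))"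
  using assms by (simp add: cp_incl2_eq sum_distrib_left tens2_mult)

lemma k_J_basis:
  assumes C: "g \<in> C" "h \<in> C"
  shows "k (tens 1 (g, h)) * J (n *\<^sub>C star (tens 1 (g, h))) = tens2 (tens 1 (g, \<one>)) (\<one>, h)"
proof -
  let ?Y = "n *\<^sub>C star (tens 1 (g, h))"
  \<comment> \<open>The dual action selects \<open>z = h\<close> and shifts the first index by
    \<open>inv w\<close>; the product in the double then forces \<open>w = \<one>\<close>. The
    factor \<open>n\<close> later cancels the \<open>1 / n\<close> in \<open>k\<close>.\<close>
  have prod: "tens 1 (g, h) * dact (w, inv z) ?Y =
      (if z = h then if w = \<one> then n *\<^sub>C tens 1 (g, \<one>) else 0 else 0)"
    if "w \<in> C" "z \<in> C" for w z
  proof -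
    have "g = h \<otimes> (inv h \<otimes> g \<otimes> h \<otimes> inv w) \<otimes> inv h \<longleftrightarrow> w = \<one>"
    proof -
      have "h \<otimes> (inv h \<otimes> g \<otimes> h \<otimes> inv w) \<otimes> inv h = g \<otimes> (h \<otimes> inv w \<otimes> inv h)"
        using C that by (simp add: m_assoc) (simp add: m_assoc [symmetric])
      moreover have "g = g \<otimes> (h \<otimes> inv w \<otimes> inv h) \<longleftrightarrow> h \<otimes> inv w \<otimes> inv h = \<one>"
        using C that by (metis r_cancel_one' inv_closed l_cancel_one' m_closed)
      moreover have "h \<otimes> inv w \<otimes> inv h = \<one> \<longleftrightarrow> w = \<one>"
        using C that
        by (metis inv_closed inv_inv inv_one l_cancel_one' inv_equality inv_solve_right r_inv
            m_closed r_one l_one inv_solve_right')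
      ultimately show ?thesis by metis
    qed
    moreover have "inv z = inv h \<longleftrightarrow> z = h" using C that by (metis inv_inv)
    ultimately show ?thesis
      using C that
      by (simp add: star_tens_one bounded_clinear_scaleC[OF dact_bounded] dual.dact_tens
          mult_scaleC_right tens_mult_one Floc_one)
  qed
  have zero: "tens2 0 i = 0" if "i \<in> C \<times> C" for i using that by (rule linear_0[OF tens2_linear])
  have "k (tens 1 (g, h)) * J ?Y = (1 / n) *\<^sub>C (\<Sum>w\<in>C. \<Sum>z\<in>C.
      tens2 (tens 1 (g, h) * dact (w, inv z) ?Y) (z \<otimes> w \<otimes> inv z, z))"
    by (simp add: k_def mult_scaleC_left sum_distrib_right tens2_J)
  also have "\<dots> = (1 / n) *\<^sub>C (\<Sum>w\<in>C. \<Sum>z\<in>C.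
      if z = h then if w = \<one> then tens2 (n *\<^sub>C tens 1 (g, \<one>)) (\<one>, h) else 0 else 0)"
    by (intro arg_cong[of _ _ "(*\<^sub>C) (1 / n)"] sum.cong) (auto simp: prod zero)
  also have "\<dots> = (1 / n) *\<^sub>C tens2 (n *\<^sub>C tens 1 (g, \<one>)) (\<one>, h)"
    using C by (simp add: finite_carrier)
  also have "\<dots> = tens2 (tens 1 (g, \<one>)) (\<one>, h)"
    using C by (simp add: bounded_clinear_scaleC[OF tens2_bounded] scaleC_scaleC)
  finally show ?thesis .
qed

text \<open>Summing over \<open>g\<close> produces the unit of the double, summing over
  \<open>h\<close> that of its dual.\<close>

lemma k_J_sum: "(\<Sum>i\<in>C \<times> C. k (tens 1 i) * J (n *\<^sub>C star (tens 1 i))) = 1"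
proof -
  have "(\<Sum>i\<in>C \<times> C. k (tens 1 i) * J (n *\<^sub>C star (tens 1 i))) =
      (\<Sum>g\<in>C. \<Sum>h\<in>C. tens2 (tens 1 (g, \<one>)) (\<one>, h))"
    unfolding sum.cartesian_product by (intro sum.cong) (auto simp: k_J_basis)
  also have "\<dots> = (\<Sum>h\<in>C. \<Sum>g\<in>C. tens2 (tens 1 (g, \<one>)) (\<one>, h))" by (rule sum.swap)
  also have "\<dots> = J (\<iota> 1)"
    unfolding cp_incl2_eq cp_incl_eq by (intro sum.cong) (simp_all add: linear_sum[OF tens2_linear])
  finally show ?thesis by (simp add: cp.unit cp2.unit)
qed

text \<open>The product in the double forces \<open>g = g'\<close> and \<open>E\<close> then forces
  \<open>h = h'\<close>; what remains is \<open>1 / n\<close>, cancelled by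
  \<open>n\<close>.\<close>

lemma cond_exp2_basis:
  assumes C: "g \<in> C" "h \<in> C" "g' \<in> C" "h' \<in> C"
  shows "E (n *\<^sub>C star (tens 1 (g, h)) * tens 1 (g', h')) = (if (g, h) = (g', h') then 1 else 0)"
proof -
  have "inv h \<otimes> g \<otimes> h = inv h \<otimes> g' \<otimes> inv (inv h) \<longleftrightarrow> g = g'"
    using C by (simp add: m_assoc)
  moreover have "inv h \<otimes> h' = \<one> \<longleftrightarrow> h = h'"
    using C by (metis inv_closed inv_equality inv_inv l_inv)
  ultimately have "star (tens 1 (g, h)) * tens 1 (g', h') =
      (if g = g' then tens 1 (inv h \<otimes> g \<otimes> h, inv h \<otimes> h') else 0)"
    using C by (simp add: star_tens_one tens_mult_one Floc_one)
  moreover have "E (n *\<^sub>C X) = n *\<^sub>C E X" for X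
    by (rule bounded_clinear_scaleC[OF cond_exp2_bounded])
  moreover have "E 0 = 0"
    by (intro linear_0 bounded_linear.linear bounded_clinear_linear cond_exp2_bounded)
  ultimately show ?thesis
    using C \<open>inv h \<otimes> h' = \<one> \<longleftrightarrow> h = h'\<close>
    by (simp add: mult_scaleC_left cond_exp2_tens cp.unit scaleC_scaleC)
qed

lemma quasi_basis:
  assumes E_mult: "\<And>X T. E (X * \<iota> T) = E X * \<iota> T"
  shows "(\<Sum>i\<in>C \<times> C. tens 1 i * E (n *\<^sub>C star (tens 1 i) * X)) = X"
proof -
  have E_mult_assoc: "E (X * (Y * \<iota> T)) = E (X * Y) * \<iota> T" for X Y T
    using E_mult[of "X * Y" T] by (simp add: mult.assoc)
  define R where "R = (\<lambda>X. \<Sum>i\<in>C \<times> C. tens 1 i * E (n *\<^sub>C star (tens 1 i) * X))"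
  have "bounded_linear R"
    unfolding R_def
    by (intro bounded_linear_sum bounded_linear_compose[OF bounded_linear_mult_right]
        bounded_linear_compose[OF bounded_clinear_linear[OF cond_exp2_bounded]]
        bounded_linear_mult_right)
  then interpret R: bounded_linear R .
  \<comment> \<open>Adjoints of elementary tensors have the form
    \<open>tens 1 j * \<iota> S\<close>, with the field element on the right, where \<open>E\<close>
    is linear; so orthonormality of the \<open>tens 1 i\<close> suffices.\<close>
  have "R (star Y) = star Y" for Y
  proof (rule tens_dense[of "\<lambda>Y. R (star Y) = star Y"])
    show "closed {Y. R (star Y) = star Y}"
      by (intro closed_Collect_eq R.continuous_on linear_continuous_on bounded_linear_star)
    show "R (star 0) = star 0" by (simp add: R.zero)
    show "R (star (X + Y)) = star (X + Y)" if "R (star X) = star X" "R (star Y) = star Y" for X Y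
      using that by (simp add: star_add R.add)
    fix T g h assume C: "T \<in> Floc" "g \<in> C" "h \<in> C"
    let ?j = "(inv h \<otimes> g \<otimes> h, inv h)"
    have "R (star (tens T (g, h))) =
        (\<Sum>i\<in>C \<times> C. tens 1 i * (E (n *\<^sub>C star (tens 1 i) * tens 1 ?j) * \<iota> (star T)))"
      unfolding R_def star_tens[OF C] E_mult_assoc ..
    also have "\<dots> = (\<Sum>i\<in>C \<times> C. if i = ?j then tens 1 i * \<iota> (star T) else 0)"
      using C by (intro sum.cong) (auto simp: cond_exp2_basis split: if_splits)
    also have "\<dots> = star (tens T (g, h))"
      using C by (simp add: finite_basis star_tens)
    finally show "R (star (tens T (g, h))) = star (tens T (g, h))" .
  qed
  from this[of "star X"] show ?thesis by (simp add: star_star R_def)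
qed

text \<open>
  $\mathcal F_{\mathrm{loc}}$ is locally finite-dimensional, and on a finite-dimensional space the injective map \<open>k\<close> is
  bounded below; the constants disappear when \<open>2 ^ j\<close>-th roots of powers are taken.
\<close>

lemma norm_k_iota_Floc:
  assumes T: "T \<in> Floc"
  shows "norm (k (\<iota> T)) = norm (\<iota> T)"
proof -
  interpret \<iota>: bounded_linear \<iota> by (rule bounded_clinear_linear[OF iota_bounded])
  interpret k: bounded_linear k by (rule bounded_clinear_linear[OF k_bounded])
  let ?S = "star T * T" and ?h = "star (\<iota> T) * \<iota> T"
  have S: "?S \<in> Floc" by (intro Floc_mult Floc_star T)
  have S_power: "?S ^ m \<in> Floc" for m
    by (induction m) (auto intro: Floc_one Floc_mult[OF S])
  have h: "?h = \<iota> ?S" by (simp add: star_iota T iota_mult Floc_star)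
  have h_power: "?h ^ m = \<iota> (?S ^ m)" for m
    by (induction m) (simp_all add: cp.unit h iota_mult S S_power)
  have E_power: "E (?h ^ m) = ?h ^ m" for m by (simp only: h_power cond_exp2_iota)
  \<comment> \<open>Exponent 0 is excluded because \<open>k 1\<close> is the projection given by the
    integral, in general not 1.\<close>
  have k_power: "k (?h ^ Suc m) = k ?h ^ Suc m" for m
  proof (induction m)
    case (Suc m)
    have "k (?h ^ Suc (Suc m)) = k (?h * E (?h ^ Suc m))"
      by (simp only: E_power power_Suc[of ?h "Suc m"])
    also have "\<dots> = k ?h * k ?h ^ Suc m" by (simp only: k_k [symmetric] Suc)
    finally show ?case by simp
  qed simp
  have k_power2: "k (?h ^ 2 ^ j) = k ?h ^ 2 ^ j" for j
    using k_power[of "2 ^ j - 1"] by simp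
  have kh: "k ?h = star (k (\<iota> T)) * k (\<iota> T)"
    by (simp only: star_k_k h cond_exp2_iota)
  obtain B where B: "finite B" "\<And>m. ?S ^ m \<in> span B"
    using Floc_powers_in_finite_span[OF S] by blast
  \<comment> \<open>One constant \<open>c\<close> serves all powers, since they lie in a single
    finite-dimensional space.\<close>
  have "?h ^ m \<in> span (\<iota> ` B)" for m
    unfolding h_power linear_span_image[OF \<iota>.linear] using B by blast
  moreover obtain c where c_nonneg: "0 \<le> c"
      and "\<And>x. x \<in> span (\<iota> ` B) \<Longrightarrow> norm x \<le> c * norm (k x)"
    using linear_injective_on_span_bounded_below[of "\<iota> ` B" k] B k_injective linear_k
    by (metis finite_imageI)
  ultimately have c: "norm (?h ^ m) \<le> c * norm (k (?h ^ m))" for m by blast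
  have "norm ?h \<le> norm (k ?h)"
  proof (rule le_if_powers_le)
    fix j
    have "norm ?h ^ 2 ^ j = norm (?h ^ 2 ^ j)"
      by (rule norm_selfadjoint_power [symmetric]) (simp add: star_mult star_star)
    also have "\<dots> \<le> c * norm (k ?h ^ 2 ^ j)" using c[of "2 ^ j"] by (simp only: k_power2)
    also have "\<dots> \<le> c * norm (k ?h) ^ 2 ^ j"
      by (intro mult_left_mono norm_power_ineq c_nonneg)
    finally show "norm ?h ^ 2 ^ j \<le> c * norm (k ?h) ^ 2 ^ j" .
  qed simp
  \<comment> \<open>Continuity gives only the constant \<open>onorm k\<close>; the powers again
    remove it.\<close>
  moreover have "norm (k ?h) \<le> norm ?h"
  proof (rule le_if_powers_le)
    fix j
    have "norm (k ?h) ^ 2 ^ j = norm (k ?h ^ 2 ^ j)"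
      by (rule norm_selfadjoint_power [symmetric]) (simp add: kh star_mult star_star)
    also have "\<dots> \<le> onorm k * norm (?h ^ 2 ^ j)"
      unfolding k_power2 [symmetric] by (rule onorm[OF k.bounded_linear])
    also have "\<dots> \<le> onorm k * norm ?h ^ 2 ^ j"
      by (intro mult_left_mono norm_power_ineq onorm_pos_le k.bounded_linear)
    finally show "norm (k ?h) ^ 2 ^ j \<le> onorm k * norm ?h ^ 2 ^ j" .
  qed simp
  ultimately have "(norm (k (\<iota> T)))\<^sup>2 = (norm (\<iota> T))\<^sup>2"
    by (simp add: kh cstar_identity)
  then show ?thesis by simp
qed

lemma norm_k_iota: "norm (k (\<iota> T)) = norm (\<iota> T)"
proof -
  interpret \<iota>: bounded_linear \<iota> by (rule bounded_clinear_linear[OF iota_bounded])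
  interpret k: bounded_linear k by (rule bounded_clinear_linear[OF k_bounded])
  have "closed {T. norm (k (\<iota> T)) = norm (\<iota> T)}"
    by (intro closed_Collect_eq continuous_on_norm k.continuous_on \<iota>.continuous_on
        continuous_on_id)
  then have "closure Floc \<subseteq> {T. norm (k (\<iota> T)) = norm (\<iota> T)}"
    by (intro closure_minimal) (auto simp: norm_k_iota_Floc)
  then show ?thesis using dense by auto
qed

end

theorem theorem4p1:
  fixes G :: "('g, 'z) monoid_scheme"
    and \<delta> \<rho> :: "'g \<Rightarrow> int \<Rightarrow> 'f::cstar_algebra"
    and act :: "'g \<times> 'g \<Rightarrow> 'f \<Rightarrow> 'f"
    and tens :: "'f \<Rightarrow> 'g \<times> 'g \<Rightarrow> 'c::cstar_algebra"
    and dact :: "'g \<times> 'g \<Rightarrow> 'c \<Rightarrow> 'c"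
    and tens2 :: "'c \<Rightarrow> 'g \<times> 'g \<Rightarrow> 'd::cstar_algebra"
    and rmul :: "'m::banach \<Rightarrow> 'c \<Rightarrow> 'm"
    and ip :: "'m \<Rightarrow> 'm \<Rightarrow> 'c"
    and \<eta> :: "'c \<Rightarrow> 'm"
  defines "F \<equiv> range (cp_incl (quantum_double G) tens)"
    and "E2 \<equiv> cond_exp2 G dact"
  assumes "group G" and "finite (carrier G)"
    and "field_algebra G \<delta> \<rho>"
    and "double_action G \<delta> \<rho> act"
    and "crossed_product (quantum_double G) act (local_field_algebra G \<delta> \<rho>) tens"
    and "dual_action G tens dact"
    and "crossed_product (dual_double G) dact UNIV tens2"
    and "hilbert_module_completion F rmul ip E2 \<eta>"
  shows "\<exists>\<Phi> :: 'd \<Rightarrow> ('m \<Rightarrow>\<^sub>L 'm).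
    cstar_isomorphism_onto rmul ip (basic_construction F rmul ip E2 \<eta>) \<Phi>"
proof -
  interpret spin_crossed_products G \<delta> \<rho> act tens dact tens2
    using assms(3-9)
    by (simp add: spin_crossed_products_def finite_field_algebra_def
        finite_field_algebra_axioms_def)
  interpret hilbert_module_completion F rmul ip E2 \<eta> by fact
  interpret basic_construction_model F rmul ip E2 \<eta> k J "carrier G \<times> carrier G"
    "tens 1" "\<lambda>i. n *\<^sub>C star (tens 1 i)"
  proof
    show "1 \<in> F" unfolding F_def using cp.unit by (metis rangeI)
    show "E2 a = a" "norm (k a) = norm a" if "a \<in> F" for a
      using that by (auto simp: F_def E2_def cond_exp2_iota norm_k_iota)
    \<comment> \<open>The right linearity of \<open>E2\<close> over \<open>F\<close> required by
      \<open>quasi_basis\<close> comes from the Hilbert module axioms, not from the crossed product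
      formulas.\<close>
    show "(\<Sum>i\<in>carrier G \<times> carrier G. tens 1 i * E2 (n *\<^sub>C star (tens 1 i) * x)) = x" for x
      unfolding E2_def
      by (rule quasi_basis) (simp add: expectation_mult_right[unfolded E2_def] F_def)
  qed (simp_all add: E2_def cond_exp2_bounded k_bounded J_k k_k star_k_k k_left_ideal k_J_sum)
  show ?thesis using cstar_isomorphism_Phi by blast
qed

end
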